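(* Let $\mathcal N$ be a 1-input regular coupled cell network with $n$ cells $\{c_1,\dots,c_n\}$ and an $m$-cell ring, with $1\le m\le n$. Assume that the cells of $\mathcal N$ are enumerated such that the corresponding adjacency matrix $A$ has the block structure $$A=\begin{bmatrix} C_{m\times m} & 0_{m\times(n-m)}\\ B_{(n-m)\times m} & L_{(n-m)\times(n-m)}\end{bmatrix},$$ where $C$ is a cyclic permutation matrix with rows and columns indexed by the cells of the ring and $L$ is a lower triangular matrix. We have: (i) The set of eigenvalues of $A$ includes the $m$ roots of unity $\omega_j=e^{\frac{2\pi i j}{m}}$, $j=0,1,\dots,m-1$. The eigenspace associated to each eigenvalue $\omega_j$ is generated by the eigenvector $v_j=(1,\omega_j,\omega_j^2,\dots,\omega_j^{m-1},v_{j,m+1},\dots,v_{j,n})$, where, for all $i\in\{m+1,\dots,n\}$, we have $v_{j,i}=\omega_j^{k}$ for some $k\in\{0,\dots,m-1\}$. (ii) If $\mathrm{depth}(\mathcal N)=0$, that is, if $m=n$, there are no more eigenvalues of $A$. If $\mathrm{depth}(\mathcal N)\neq 0$, the other eigenvalue of $A$ is zero, with algebraic multiplicity $n-m$. The associated eigenspace has dimension $t$, with $t$ the number of tails of $\mathcal N$, and a basis $(e_{i_1},\dots,e_{i_t})$, with $i_j\in\{m+1,\dots,n\}$, for $j\in\{1,\dots,t\}$, such that $c_{i_j}$ is the leaf of the tail $j$. (iii) If $\mathrm{depth}(\mathcal N)>1$, the adjacency matrix $A$ is non semi-simple and the Jordan chains associated to zero can be obtained directly from the subtrees of the directed rooted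 trees of $\mathcal N$. Let $S_{\mathcal T}$ be the set of the subtrees of the trees of $\mathcal N$. A chain of vectors $(\tilde u_s,\tilde u_{s-1},\dots,\tilde u_1)$ is a Jordan chain associated to the eigenvalue zero if and only if there is a non-empty subset $J$ of $S_{\mathcal T}$, with $s=\max\{\mathrm{depth}(\mathcal B):\mathcal B\in J\}>1$, such that the following holds. For each subtree $\mathcal B_i\in J$, with $s_i=\mathrm{depth}(\mathcal B_i)$, consider the sequence of vectors $\tilde u^i_1,\dots,\tilde u^i_{s_i},\dots,\tilde u^i_s$ for which there is $\alpha_i\in\mathbb R$ such that - $\tilde u^i_1=\alpha_i\, e_{r_i}$, with $c_{r_i}$ the root cell of $\mathcal B_i$; - for $1<j\le s_i$, $\tilde u^i_j=\alpha_i\left(e_{l_1}+\cdots+e_{l_k}\right)$, with $c_{l_1},\dots,c_{l_k}$ (depending on $i$ and $j$) the cells of the subtree $\mathcal B_i$ at distance $j-1$ from $c_{r_i}$; - $\tilde u^i_{s_i+1}=\cdots=\tilde u^i_s=0$. Then $\tilde u_j=\sum_{\mathcal B_i\in J}\tilde u^i_j$ for $1\le j\le s$.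
   Context: A 1-input regular coupled cell network is a finite connected directed graph (self-loops allowed) in which all cells (vertices) are of one type, all edges are of one type, and every cell receives exactly one edge. Its adjacency matrix $A=(a_{ij})$ has $a_{ij}$ equal to the number of edges from $c_j$ to $c_i$. A directed rooted tree is a network with a cell (the root) from which there is exactly one directed path to every other cell; its leaves are the cells with no outgoing edge, and for each leaf the directed path from the root to that leaf is a tail. A subtree of a tree is a connected subgraph of the tree; it is regarded as a directed rooted tree, with its own root cell. The depth of a directed rooted tree is the maximum, over its leaves, of the number of edges in the tail from the root to the leaf (zero if there are no leaves). A 1-input regular coupled cell network is either a ring (a directed cycle, in particular possibly a self-loop) or the coalescence of a ring with the disjoint union of finitely many directed rooted trees, the root of each tree being merged with a different cell of the ring. These are the directed rooted trees of $\mathcal N$, and their tails are the tails of $\mathcal N$. $\mathrm{depth}(\mathcal N)$ is $0$ if $\mathcal N$ is a ring, and otherwise is the maximum of the depths of its directed rooted trees. The distance from a root cell to a cell is the number of edges of the directed path from the former to the latter. $e_j\in\mathbb R^n$ is the vector with $j$-th entry $1$ and all other entries $0$. A Jordan chain $(\tilde u_s,\dots,\tilde u_1)$ associated to the eigenvalue zero is a sequence of vectors such that $\tilde u_s$ is an eigenvector for zero, so $A\tilde u_s=0$, and $A\tilde u_{j-1}=\tilde u_j$ for $2\le j\le s$. Non semi-simple means not diagonalizable.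
   Formalization: In (iii), s and s_i count levels (depth + 1), J contains only subtrees closed under outgoing edges of N, every α_i is nonzero, and the equivalence is for chains of length s>1; as stated it fails for c1→c1→c2→c3. C has its ones at (i, i+1 mod m), as (i) requires. *)

theory Defs
  imports
    "Jordan_Normal_Form.Spectral_Radius"
    "Jordan_Normal_Form.Matrix_Kernel"
    "Graph_Theory.Graph_Theory"
begin

section \<open>Networks\<close>

definition one_input_network :: "('a, 'b) pre_digraph \<Rightarrow> bool" where
  "one_input_network N \<longleftrightarrow>
     fin_digraph N \<and> Digraph_Component.connected N \<and> (\<forall>v\<in>verts N. in_degree N v = 1)"

definition ring_cells :: "('a, 'b) pre_digraph \<Rightarrow> 'a set" where
  "ring_cells N = {v \<in> verts N. v \<rightarrow>\<^sup>+\<^bsub>N\<^esub> v}"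

definition ring_graph :: "('a, 'b) pre_digraph \<Rightarrow> ('a, 'b) pre_digraph" where
  "ring_graph N = N \<restriction> ring_cells N"

text \<open>Cells are numbered from 0, as matrix rows and columns are: the cell \<open>c i\<close> is the
  one usually written with subscript \<open>i + 1\<close>. The column of a cell lists the
  cells it feeds into.\<close>

definition adjacency_mat ::
  "('a, 'b) pre_digraph \<Rightarrow> nat \<Rightarrow> (nat \<Rightarrow> 'a) \<Rightarrow> 'k::semiring_1 mat" where
  "adjacency_mat N n c =
     mat n n (\<lambda>(i, j). of_nat (card {e \<in> arcs N. tail N e = c j \<and> head N e = c i}))"

section \<open>Rooted trees\<close>

definition is_root :: "('a, 'b) pre_digraph \<Rightarrow> 'a \<Rightarrow> bool" where
  "is_root T r \<longleftrightarrow>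
     r \<in> verts T \<and> (\<forall>v \<in> verts T - {r}. \<exists>!p. pre_digraph.apath T r p v)"

definition root :: "('a, 'b) pre_digraph \<Rightarrow> 'a" where
  "root T = (THE r. is_root T r)"

definition leaves :: "('a, 'b) pre_digraph \<Rightarrow> 'a set" where
  "leaves T = {v \<in> verts T. out_arcs T v = {}}"

text \<open>A tail is represented by the list of edges of the path from the root to a leaf.\<close>

definition tree_tails :: "('a, 'b) pre_digraph \<Rightarrow> 'b list set" where
  "tree_tails T = {p. \<exists>l \<in> leaves T. pre_digraph.apath T (root T) p l}"

definition depth :: "('a, 'b) pre_digraph \<Rightarrow> nat" where
  "depth T = (if leaves T = {} then 0 else Max (length ` tree_tails T))"

definition cells_at :: "('a, 'b) pre_digraph \<Rightarrow> nat \<Rightarrow> 'a set" where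
  "cells_at T k =
     {v \<in> verts T. \<exists>p. pre_digraph.apath T (root T) p v \<and> length p = k}"

text \<open>A subtree in the broad sense: any connected subgraph.\<close>

definition subtrees :: "('a, 'b) pre_digraph \<Rightarrow> ('a, 'b) pre_digraph set" where
  "subtrees T = {B. subgraph B T \<and> Digraph_Component.connected B}"

section \<open>The directed rooted trees of a network\<close>

text \<open>Deleting the ring edges undoes the coalescence: what hangs from a ring cell \<open>r\<close> is
  everything that \<open>r\<close> still reaches. A ring cell that feeds only into the ring carries
  no tree; the one-cell remainder at such a cell is therefore not counted (its only
  leaf would be a cell of the ring).\<close>

definition without_ring :: "('a, 'b) pre_digraph \<Rightarrow> ('a, 'b) pre_digraph" where
  "without_ring N = N\<lparr>arcs := arcs N - arcs (ring_graph N)\<rparr>"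

definition tree_at :: "('a, 'b) pre_digraph \<Rightarrow> 'a \<Rightarrow> ('a, 'b) pre_digraph" where
  "tree_at N r = without_ring N \<restriction> {v. r \<rightarrow>\<^sup>*\<^bsub>without_ring N\<^esub> v}"

definition network_trees :: "('a, 'b) pre_digraph \<Rightarrow> ('a, 'b) pre_digraph set" where
  "network_trees N = {tree_at N r | r. r \<in> ring_cells N \<and> arcs (tree_at N r) \<noteq> {}}"

definition network_tails :: "('a, 'b) pre_digraph \<Rightarrow> 'b list set" where
  "network_tails N = (\<Union>T \<in> network_trees N. tree_tails T)"

text \<open>Tails of a network are nonempty lists, because the trees of a network have an edge.\<close>

definition tail_leaf :: "('a, 'b) pre_digraph \<Rightarrow> 'b list \<Rightarrow> 'a" where
  "tail_leaf N p = head N (last p)"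

definition network_depth :: "('a, 'b) pre_digraph \<Rightarrow> nat" where
  "network_depth N = (if network_trees N = {} then 0 else Max (depth ` network_trees N))"

definition network_subtrees :: "('a, 'b) pre_digraph \<Rightarrow> ('a, 'b) pre_digraph set" where
  "network_subtrees N = (\<Union>T \<in> network_trees N. subtrees T)"

text \<open>A subtree consisting of a cell together with everything below it. Edges are taken in
  the whole network, not just in the tree, so that such a subtree cannot contain a
  cell of the ring (which feeds into the next ring cell). Only these
  subtrees produce Jordan chains: for any other subtree the adjacency matrix moves
  some level of the subtree outside of it.\<close>

definition descendant_closed :: "('a, 'b) pre_digraph \<Rightarrow> ('a, 'b) pre_digraph \<Rightarrow> bool" where
  "descendant_closed N B \<longleftrightarrow> (\<forall>v \<in> verts B. out_arcs N v \<subseteq> arcs B)"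

section \<open>Linear algebra\<close>

text \<open>The orientation is the one for which \<open>(1, w, w\<^sup>2, \<dots>)\<close> is an
  eigenvector for the eigenvalue \<open>w\<close> (and not for its inverse).\<close>

definition cyclic_perm_mat :: "nat \<Rightarrow> 'k::semiring_1 mat" where
  "cyclic_perm_mat m = mat m m (\<lambda>(i, j). if j = (i + 1) mod m then 1 else 0)"

definition lower_triangular :: "'k::zero mat \<Rightarrow> bool" where
  "lower_triangular L \<longleftrightarrow>
     (\<forall>i < dim_row L. \<forall>j < dim_col L. i < j \<longrightarrow> L $$ (i, j) = 0)"

definition root_of_unity :: "nat \<Rightarrow> nat \<Rightarrow> complex" where
  "root_of_unity m j = exp (2 * of_real pi * \<i> * of_nat j / of_nat m)"

definition eigenspace :: "'k::field mat \<Rightarrow> 'k \<Rightarrow> 'k vec set" where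
  "eigenspace A k = {v \<in> carrier_vec (dim_row A). A *\<^sub>v v = k \<cdot>\<^sub>v v}"

abbreviation eigenspace_module :: "'k::field mat \<Rightarrow> 'k \<Rightarrow> ('k, 'k vec) module" where
  "eigenspace_module A k \<equiv>
     (module_vec TYPE('k) (dim_row A)) \<lparr>carrier := eigenspace A k\<rparr>"

definition diagonalizable :: "'k::field mat \<Rightarrow> bool" where
  "diagonalizable A \<longleftrightarrow> (\<exists>D. similar_mat A D \<and> diagonal_mat D)"

text \<open>The chain is \<open>(u s, \<dots>, u 1)\<close>; values of \<open>u\<close> outside \<open>{1..s}\<close> are irrelevant.\<close>

definition jordan_chain_zero :: "'k::field mat \<Rightarrow> nat \<Rightarrow> (nat \<Rightarrow> 'k vec) \<Rightarrow> bool" where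
  "jordan_chain_zero A s u \<longleftrightarrow>
     1 \<le> s \<and> (\<forall>j\<in>{1..s}. u j \<in> carrier_vec (dim_row A)) \<and>
     eigenvector A (u s) 0 \<and> (\<forall>j\<in>{2..s}. A *\<^sub>v u (j - 1) = u j)"

section \<open>Vectors attached to a subtree\<close>

text \<open>The number of levels of \<open>B\<close>, that is, the depth counted in cells rather than in
  edges: the root is level 1 and the cells at distance \<open>j - 1\<close> from it form level \<open>j\<close>,
  so the nonempty levels are exactly \<open>1, \<dots>, depth B + 1\<close>.\<close>

definition levels :: "('a, 'b) pre_digraph \<Rightarrow> nat" where
  "levels B = depth B + 1"

text \<open>The scalar must be nonzero: otherwise the sequence is zero and so is, for instance, the sum
  for a single subtree, which is no Jordan chain.\<close>

definition subtree_vectors ::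
  "nat \<Rightarrow> (nat \<Rightarrow> 'a) \<Rightarrow> nat \<Rightarrow> ('a, 'b) pre_digraph \<Rightarrow> (nat \<Rightarrow> real vec) \<Rightarrow> bool" where
  "subtree_vectors n c s B w \<longleftrightarrow>
     (\<exists>\<alpha>. \<alpha> \<noteq> 0 \<and>
        (\<exists>r<n. c r = root B \<and> w 1 = \<alpha> \<cdot>\<^sub>v unit_vec n r) \<and>
        (\<forall>j. 1 < j \<and> j \<le> levels B \<longrightarrow>
           w j = \<alpha> \<cdot>\<^sub>v finsum_vec TYPE(real) n (unit_vec n)
                          {l. l < n \<and> c l \<in> cells_at B (j - 1)}) \<and>
        (\<forall>j. levels B < j \<and> j \<le> s \<longrightarrow> w j = 0\<^sub>v n))"

end

theory Submission
  imports Defs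
begin

text \<open>
Every cell of the network receives one edge, so the network is the graph of a map, its feeder map,
which sends a cell to the cell that feeds it. In terms of cell numbers this is a self-map \<open>\<pi>\<close> of
\<open>{..<n}\<close>, and the adjacency matrix acts on vectors by composition, \<open>A v = v \<circ> \<pi>\<close>; hence
\<open>A\<^sup>k v = v \<circ> \<pi>\<^sup>k\<close>. The ring consists of the periodic points of \<open>\<pi>\<close>. The prescribed block form of
\<open>A\<close> says that \<open>\<pi> i = i + 1\<close> modulo \<open>m\<close> on the ring and \<open>\<pi> i < i\<close> off the ring. Everything
is read off from this.

An eigenvector for \<open>k \<noteq> 0\<close> satisfies \<open>v (\<pi> i) = k v i\<close>. It is determined by its value at cell 0,
because every cell is carried onto the ring by iterating \<open>\<pi>\<close>, and running once around the ring forces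
\<open>k\<^sup>m = 1\<close>. Conversely, if \<open>k\<^sup>m = 1\<close> then \<open>k\<close> raised to the place on the ring that cell \<open>i\<close>
reaches after a multiple of \<open>m\<close> steps is an eigenvector (\<open>eigenspace_root_of_unity\<close>). The
kernel consists of the vectors that vanish on the image of \<open>\<pi>\<close>. The cells outside this image are the
cells without outgoing edge, and these correspond to the tails of the network
(\<open>bij_betw_tail_leaf\<close>). The algebraic multiplicity of 0 comes from the block form, the lower
right block being strictly lower triangular (\<open>order_0_char_poly\<close>).

A Jordan chain for 0 is \<open>u, A u, \<dots>, A\<^sup>s\<^sup>-\<^sup>1 u\<close> with \<open>A\<^sup>s u = 0\<close> and \<open>A\<^sup>s\<^sup>-\<^sup>1 u \<noteq> 0\<close>. Since \<open>\<pi>\<close>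
permutes the ring, \<open>u\<close> vanishes there. Write \<open>u\<close> as a combination of unit vectors \<open>e\<^sub>x\<close> with nonzero
coefficients. The vector \<open>A\<^sup>k e\<^sub>x\<close> is the indicator of the cells that \<open>\<pi>\<^sup>k\<close> sends to \<open>x\<close>, that is, of
the cells at distance \<open>k\<close> below \<open>x\<close>. Indicators that belong to different \<open>x\<close> are disjoint, so nothing
cancels, and \<open>s\<close> is the largest number of levels of the subtrees hanging from the cells \<open>x\<close> that occur
(\<open>jordan_chain_zero_iff_supported\<close>). Finally, the descendant closed subtrees are precisely those that
consist of a cell off the ring and everything below it (\<open>descendant_closed_subtrees_eq\<close>).
\<close>

section \<open>Walks from a source and arborescences\<close>

lemma (in wf_digraph) awalk_snoc_iff:
  "awalk u (p @ [e]) v \<longleftrightarrow> awalk u p (tail G e) \<and> e \<in> arcs G \<and> head G e = v"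
proof -
  have "awlast u p = tail G e" if "awalk u p (tail G e)" using that by auto
  then show ?thesis by (auto simp: awalk_Cons_iff awalk_Nil_iff)
qed

text \<open>When no vertex is entered by two arcs, a walk is determined backwards from its end.
  Two walks with the same end thus share a suffix, and if they had different lengths, the shorter
  one would start at a vertex entered by an arc of the longer one.\<close>

lemma (in wf_digraph) awalk_from_source_unique:
  assumes inj: "inj_on (head G) (arcs G)"
    and u: "\<And>e. e \<in> arcs G \<Longrightarrow> head G e \<noteq> u"
    and u': "\<And>e. e \<in> arcs G \<Longrightarrow> head G e \<noteq> u'"
    and "awalk u p v" "awalk u' q v"
  shows "p = q"
  using assms(4,5)
proof (induction p arbitrary: v q rule: rev_induct)
  case Nil
  then have "v = u" by (simp add: awalk_Nil_iff)
  with Nil(2) u show ?case by (cases q rule: rev_cases) (auto simp del: awalk_append_iff simp: awalk_snoc_iff)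
next
  case (snoc e p)
  then have e: "awalk u p (tail G e)" "e \<in> arcs G" "head G e = v"
    by (simp_all del: awalk_append_iff add: awalk_snoc_iff)
  show ?case
  proof (cases q rule: rev_cases)
    case Nil
    with snoc(3) have "v = u'" by (simp add: awalk_Nil_iff)
    with e u' show ?thesis by blast
  next
    case (snoc q' f)
    with \<open>awalk u' q v\<close> have f: "awalk u' q' (tail G f)" "f \<in> arcs G" "head G f = v"
      by (simp_all del: awalk_append_iff add: awalk_snoc_iff)
    then have "f = e" using inj e by (auto dest: inj_onD)
    with snoc.IH[OF e(1)] f snoc show ?thesis by simp
  qed
qed

text \<open>If a vertex were visited twice, the walk up to the first visit and the walk up to the
  second would be two walks from the source to that vertex.\<close>

lemma (in wf_digraph) awalk_from_source_apath:
  assumes inj: "inj_on (head G) (arcs G)"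
    and u: "\<And>e. e \<in> arcs G \<Longrightarrow> head G e \<noteq> u"
    and "awalk u p v"
  shows "apath u p v"
  using assms(3)
proof (induction p arbitrary: v rule: rev_induct)
  case Nil
  then show ?case by (auto simp: awalk_Nil_iff apath_Nil_iff)
next
  case (snoc e p)
  then have e: "awalk u p (tail G e)" "e \<in> arcs G" "head G e = v"
    by (simp_all del: awalk_append_iff add: awalk_snoc_iff)
  have "v \<notin> set (awalk_verts u p)"
  proof
    assume "v \<in> set (awalk_verts u p)"
    from awalk_decomp[OF e(1) this] obtain q r where "awalk u q v" "p = q @ r" by blast
    with awalk_from_source_unique[OF inj u u \<open>awalk u q v\<close> snoc.prems] show False by simp
  qed
  moreover have "awalk_verts u (p @ [e]) = awalk_verts u p @ [v]"
    by (subst awalk_verts_append[OF snoc.prems]) (simp add: e)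
  ultimately show ?case using snoc.IH[OF e(1)] snoc.prems by (simp add: apath_def)
qed

lemma leaves_iff: "v \<in> leaves G \<longleftrightarrow> v \<in> verts G \<and> (\<forall>e\<in>arcs G. tail G e \<noteq> v)"
  by (auto simp: leaves_def out_arcs_def)

text \<open>Rooted trees, characterized without the uniqueness of paths: the conditions on single
  arcs are easy to check for the graphs below, and uniqueness follows from them.\<close>

locale arborescence = fin_digraph T for T :: "('a, 'b) pre_digraph" (structure) +
  fixes r :: 'a
  assumes root_in_verts: "r \<in> verts T"
    and inj_head: "inj_on (head T) (arcs T)"
    and no_arc_into_root: "e \<in> arcs T \<Longrightarrow> head T e \<noteq> r"
    and reachable_from_root: "v \<in> verts T \<Longrightarrow> r \<rightarrow>\<^sup>* v"
begin

lemma apath_iff_awalk: "apath r p v \<longleftrightarrow> awalk r p v"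
  using awalk_from_source_apath[OF inj_head no_arc_into_root] by (auto simp: apath_def)

lemma awalk_unique: "awalk r p v \<Longrightarrow> awalk r q v \<Longrightarrow> p = q"
  by (rule awalk_from_source_unique[OF inj_head no_arc_into_root no_arc_into_root])

lemma awalk_from_root_exists: "v \<in> verts T \<Longrightarrow> \<exists>p. awalk r p v"
  using reachable_from_root reachable_awalk by blast

lemma root_eq: "root T = r"
  unfolding root_def
proof (rule the_equality)
  show "is_root T r"
    unfolding is_root_def apath_iff_awalk
    using root_in_verts awalk_from_root_exists awalk_unique by blast
next
  fix r' assume r': "is_root T r'"
  show "r' = r"
  proof (rule ccontr)
    assume "r' \<noteq> r"
    then obtain p where "apath r' p r" using r' root_in_verts unfolding is_root_def by blast
    then have "awalk r' p r" by (simp add: apath_def)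
    then show False using \<open>r' \<noteq> r\<close> no_arc_into_root
      by (cases p rule: rev_cases) (auto simp: awalk_snoc_iff awalk_Nil_iff simp del: awalk_append_iff)
  qed
qed

lemma tree_tails_eq: "tree_tails T = {p. \<exists>l \<in> leaves T. awalk r p l}"
  by (simp add: tree_tails_def root_eq apath_iff_awalk)

lemma cells_at_eq: "cells_at T k = {v. \<exists>p. awalk r p v \<and> length p = k}"
  by (auto simp: cells_at_def root_eq apath_iff_awalk)

lemma cells_at_0: "cells_at T 0 = {r}"
  using root_in_verts by (auto simp: cells_at_eq awalk_Nil_iff)

text \<open>This recursion is the link between levels of a tree and iterates of the feeder
  map.\<close>

lemma cells_at_Suc: "cells_at T (Suc k) = head T ` {e \<in> arcs T. tail T e \<in> cells_at T k}"
proof (intro Set.set_eqI iffI)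
  fix v assume "v \<in> cells_at T (Suc k)"
  then obtain p where p: "awalk r p v" "length p = Suc k" by (auto simp: cells_at_eq)
  then obtain q e where "p = q @ [e]" by (cases p rule: rev_cases) auto
  with p show "v \<in> head T ` {e \<in> arcs T. tail T e \<in> cells_at T k}"
    by (auto simp: awalk_snoc_iff cells_at_eq simp del: awalk_append_iff)
next
  fix v assume "v \<in> head T ` {e \<in> arcs T. tail T e \<in> cells_at T k}"
  then obtain e p where "e \<in> arcs T" "awalk r p (tail T e)" "length p = k" "head T e = v"
    by (auto simp: cells_at_eq)
  then show "v \<in> cells_at T (Suc k)"
    by (auto simp: awalk_snoc_iff cells_at_eq simp del: awalk_append_iff intro!: exI[of _ "p @ [e]"])
qed

lemma awalk_length_less: "awalk r p v \<Longrightarrow> length p < card (verts T)"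
  using apath_iff_awalk length_apath_less by blast

text \<open>A walk of maximal length cannot be prolonged, so it ends in a leaf and is a tail.
  Lengths are bounded because walks from the root repeat no vertex.\<close>

lemma longest_tail:
  obtains p where "p \<in> tree_tails T" "\<forall>q v. awalk r q v \<longrightarrow> length q \<le> length p"
proof -
  let ?P = "\<lambda>p. \<exists>v. awalk r p v"
  have "?P []" using root_in_verts by (simp add: awalk_Nil_iff)
  moreover have "\<forall>p. ?P p \<longrightarrow> length p < card (verts T)"
    using awalk_length_less by blast
  ultimately have "\<exists>p. ?P p \<and> (\<forall>q. ?P q \<longrightarrow> length q \<le> length p)"
    by (rule ex_has_greatest_nat[of ?P])
  then obtain p v where p: "awalk r p v" and mx: "\<forall>q v. awalk r q v \<longrightarrow> length q \<le> length p"
    by blast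
  have "out_arcs T v = {}"
  proof (rule ccontr)
    assume "out_arcs T v \<noteq> {}"
    then obtain e where "e \<in> out_arcs T v" by blast
    then have "e \<in> arcs T" "tail T e = v" by simp_all
    with p have "awalk r (p @ [e]) (head T e)" by (simp add: awalk_snoc_iff del: awalk_append_iff)
    with mx have "length (p @ [e]) \<le> length p" by blast
    then show False by simp
  qed
  then have "v \<in> leaves T" using p by (auto simp: leaves_def)
  with p have "p \<in> tree_tails T" by (auto simp: tree_tails_eq)
  with mx show ?thesis by (rule that[rotated])
qed

lemma finite_tree_tails: "finite (tree_tails T)"
proof -
  have "tree_tails T \<subseteq> {p. set p \<subseteq> arcs T \<and> length p \<le> card (verts T)}"
    unfolding tree_tails_eq using awalk_length_less less_imp_le by blast
  moreover have "finite {p. set p \<subseteq> arcs T \<and> length p \<le> card (verts T)}"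
    by (rule finite_lists_length_le) (rule finite_arcs)
  ultimately show ?thesis by (rule finite_subset)
qed

text \<open>The depth is a maximum over tails only; by \<open>longest_tail\<close> it bounds all
  walks from the root.\<close>

lemma depth_maximal: "awalk r q v \<Longrightarrow> length q \<le> depth T"
  and depth_attained: "\<exists>p v. awalk r p v \<and> length p = depth T"
proof -
  obtain p where p: "p \<in> tree_tails T" "\<forall>q v. awalk r q v \<longrightarrow> length q \<le> length p"
    by (rule longest_tail)
  from p(1) have "leaves T \<noteq> {}" by (auto simp: tree_tails_eq)
  moreover have "Max (length ` tree_tails T) = length p"
  proof (rule Max_eqI)
    show "finite (length ` tree_tails T)" using finite_tree_tails by simp
    show "length p \<in> length ` tree_tails T" using p(1) by simp
  next
    fix k assume "k \<in> length ` tree_tails T"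
    then obtain q v where "awalk r q v" "k = length q" by (auto simp: tree_tails_eq)
    with p(2) show "k \<le> length p" by blast
  qed
  ultimately have d: "depth T = length p" by (simp add: depth_def)
  show "awalk r q v \<Longrightarrow> length q \<le> depth T" using p(2) d by metis
  show "\<exists>p v. awalk r p v \<and> length p = depth T" using p(1) d by (auto simp: tree_tails_eq)
qed

lemma cells_at_depth: "cells_at T (depth T) \<noteq> {}"
  using depth_attained by (auto simp: cells_at_eq)

lemma cells_at_beyond_depth:
  assumes "depth T < k"
  shows "cells_at T k = {}"
proof (rule ccontr)
  assume "cells_at T k \<noteq> {}"
  then obtain p v where "awalk r p v" "length p = k" unfolding cells_at_eq by blast
  with depth_maximal[of p v] assms show False by simp
qed

end

section \<open>One-input graphs and their feeder map\<close>

lemma awalk_subgraph: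
  assumes "verts H \<subseteq> verts G" "arcs H \<subseteq> arcs G" "tail H = tail G" "head H = head G"
    and "pre_digraph.awalk H u p v"
  shows "pre_digraph.awalk G u p v"
proof -
  have "compatible H G" using assms(3,4) by (simp add: compatible_def)
  then have "pre_digraph.cas H u p v = pre_digraph.cas G u p v" by (simp add: compatible_cas)
  with assms show ?thesis by (auto simp: pre_digraph.awalk_def)
qed

text \<open>Finite graphs of self-maps of the vertex set, each vertex being mapped to the tail of
  its only incoming arc.\<close>

locale one_input_graph = fin_digraph N for N :: "('a, 'b) pre_digraph" (structure) +
  assumes in_degree_1: "v \<in> verts N \<Longrightarrow> in_degree N v = 1"
begin

definition feeder :: "'a \<Rightarrow> 'a" where
  "feeder v = tail N (THE e. e \<in> in_arcs N v)"

lemma in_arc_unique: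
  assumes "e \<in> arcs N" "f \<in> arcs N" "head N e = head N f"
  shows "e = f"
proof -
  have "head N f \<in> verts N" using assms by simp
  then have "card (in_arcs N (head N f)) = 1" using in_degree_1 by (simp add: in_degree_def)
  then obtain g where g: "in_arcs N (head N f) = {g}" using card_1_singletonE by blast
  have "e \<in> in_arcs N (head N f)" "f \<in> in_arcs N (head N f)" using assms by simp_all
  with g show ?thesis by simp
qed

lemma inj_head: "inj_on (head N) (arcs N)"
  using in_arc_unique by (auto intro: inj_onI)

lemma feeder_head: 
  assumes "e \<in> arcs N"
  shows "feeder (head N e) = tail N e"
proof -
  have "(THE f. f \<in> in_arcs N (head N e)) = e"
    using assms in_arc_unique by (intro the_equality) auto
  then show ?thesis by (simp add: feeder_def)
qed

lemma in_arc_exists: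
  assumes "v \<in> verts N"
  obtains e where "e \<in> arcs N" "head N e = v" "tail N e = feeder v"
proof -
  have "card (in_arcs N v) = 1" using in_degree_1 assms by (simp add: in_degree_def)
  then have "in_arcs N v \<noteq> {}" by auto
  then obtain e where "e \<in> in_arcs N v" by blast
  then have "e \<in> arcs N" "head N e = v" by auto
  with feeder_head[of e] that show ?thesis by auto
qed

lemma feeder_in_verts: "v \<in> verts N \<Longrightarrow> feeder v \<in> verts N"
  by (metis in_arc_exists tail_in_verts)

lemma feeder_pow_in_verts: "v \<in> verts N \<Longrightarrow> (feeder ^^ k) v \<in> verts N"
  by (induction k) (auto intro: feeder_in_verts)

lemma awalk_feeder: "awalk u p v \<Longrightarrow> (feeder ^^ length p) v = u"
proof (induction p arbitrary: v rule: rev_induct)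
  case Nil
  then show ?case by (simp add: awalk_Nil_iff)
next
  case (snoc e p)
  then have e: "awalk u p (tail N e)" "e \<in> arcs N" "head N e = v"
    by (simp_all del: awalk_append_iff add: awalk_snoc_iff)
  then show ?case using snoc.IH[OF e(1)] feeder_head[of e] by (simp add: funpow_Suc_right del: funpow.simps)
qed

lemma awalk_from_feeder_pow: "v \<in> verts N \<Longrightarrow> \<exists>p. awalk ((feeder ^^ k) v) p v \<and> length p = k"
proof (induction k arbitrary: v)
  case 0
  then show ?case by (auto simp: awalk_Nil_iff)
next
  case (Suc k)
  obtain e where e: "e \<in> arcs N" "head N e = v" "tail N e = feeder v"
    using in_arc_exists[OF Suc.prems] .
  obtain p where "awalk ((feeder ^^ k) (feeder v)) p (feeder v)" "length p = k"
    using Suc.IH[OF feeder_in_verts[OF Suc.prems]] by blast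
  with e have "awalk ((feeder ^^ Suc k) v) (p @ [e]) v" "length (p @ [e]) = Suc k"
    by (simp_all add: awalk_snoc_iff funpow_Suc_right del: awalk_append_iff funpow.simps)
  then show ?case by blast
qed

text \<open>A walk of length \<open>k\<close> ending in \<open>v\<close> can only start in the
  \<open>k\<close>-th iterate of the feeder map at \<open>v\<close>.\<close>

lemma reachable_iff_feeder_pow: "u \<rightarrow>\<^sup>* v \<longleftrightarrow> v \<in> verts N \<and> (\<exists>k. (feeder ^^ k) v = u)"
  using awalk_feeder awalk_from_feeder_pow awalk_last_in_verts
  unfolding reachable_awalk by metis

lemma ring_cells_iff: "v \<in> ring_cells N \<longleftrightarrow> v \<in> verts N \<and> (\<exists>k>0. (feeder ^^ k) v = v)"
proof
  assume "v \<in> ring_cells N"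
  then obtain p where "v \<in> verts N" "awalk v p v" "p \<noteq> []"
    by (auto simp: ring_cells_def reachable1_awalk)
  then show "v \<in> verts N \<and> (\<exists>k>0. (feeder ^^ k) v = v)"
    using awalk_feeder by blast
next
  assume "v \<in> verts N \<and> (\<exists>k>0. (feeder ^^ k) v = v)"
  then obtain k where k: "v \<in> verts N" "k > 0" "(feeder ^^ k) v = v" by blast
  then obtain p where "awalk v p v" "length p = k" using awalk_from_feeder_pow by metis
  with k show "v \<in> ring_cells N" by (auto simp: ring_cells_def reachable1_awalk)
qed

lemma ring_cells_in_verts: "v \<in> ring_cells N \<Longrightarrow> v \<in> verts N"
  by (simp add: ring_cells_iff)

lemma feeder_ring:
  assumes "v \<in> ring_cells N"
  shows "feeder v \<in> ring_cells N"
proof -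
  obtain k where "v \<in> verts N" "k > 0" "(feeder ^^ k) v = v" using assms ring_cells_iff by blast
  moreover from this have "(feeder ^^ k) (feeder v) = feeder v" by (metis funpow_swap1)
  ultimately show ?thesis using feeder_in_verts ring_cells_iff by blast
qed

lemma feeder_pow_ring: "v \<in> ring_cells N \<Longrightarrow> (feeder ^^ k) v \<in> ring_cells N"
  by (induction k) (auto intro: feeder_ring)

text \<open>By the pigeonhole principle the orbit of \<open>v\<close> under the feeder map becomes
  periodic.\<close>

lemma reaches_ring:
  assumes "v \<in> verts N"
  obtains k where "(feeder ^^ k) v \<in> ring_cells N"
proof -
  have "range (\<lambda>k. (feeder ^^ k) v) \<subseteq> verts N" using feeder_pow_in_verts assms by blast
  then have "finite (range (\<lambda>k. (feeder ^^ k) v))" by (rule finite_subset) simp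
  then have "\<not> inj (\<lambda>k. (feeder ^^ k) v)" using finite_imageD infinite_UNIV_nat by blast
  then obtain i j where "i < j" and eq: "(feeder ^^ i) v = (feeder ^^ j) v"
    unfolding inj_def by (metis linorder_neqE_nat)
  then have "(feeder ^^ (j - i)) ((feeder ^^ i) v) = (feeder ^^ i) v"
    by (metis funpow_add o_apply le_add_diff_inverse2 less_imp_le)
  with \<open>i < j\<close> have "(feeder ^^ i) v \<in> ring_cells N"
    using ring_cells_iff feeder_pow_in_verts[OF assms] zero_less_diff by blast
  then show ?thesis by (rule that)
qed

lemma ring_tail: "e \<in> arcs N \<Longrightarrow> head N e \<in> ring_cells N \<Longrightarrow> tail N e \<in> ring_cells N"
  using feeder_ring[of "head N e"] feeder_head[of e] by simp

lemma reachable_from_non_ring: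
  assumes "x \<notin> ring_cells N" "x \<rightarrow>\<^sup>* v"
  shows "v \<notin> ring_cells N"
proof
  assume "v \<in> ring_cells N"
  moreover obtain k where "(feeder ^^ k) v = x" using assms(2) reachable_iff_feeder_pow by blast
  ultimately show False using feeder_pow_ring[of v k] assms(1) by simp
qed

lemma verts_without_ring [simp]: "verts (without_ring N) = verts N"
  and tail_without_ring [simp]: "tail (without_ring N) = tail N"
  and head_without_ring [simp]: "head (without_ring N) = head N"
  by (simp_all add: without_ring_def)

text \<open>The feeder of a ring cell is a ring cell, so the ring arcs are the arcs whose head
  lies on the ring.\<close>

lemma arcs_without_ring [simp]:
  "arcs (without_ring N) = {e \<in> arcs N. head N e \<notin> ring_cells N}"
  using ring_tail by (auto simp: without_ring_def ring_graph_def)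

lemma fin_digraph_without_ring: "fin_digraph (without_ring N)"
  by unfold_locales auto

lemma without_ring_reachable_imp: "u \<rightarrow>\<^sup>*\<^bsub>without_ring N\<^esub> v \<Longrightarrow> u \<rightarrow>\<^sup>* v"
proof -
  interpret W: fin_digraph "without_ring N" by (rule fin_digraph_without_ring)
  assume "u \<rightarrow>\<^sup>*\<^bsub>without_ring N\<^esub> v"
  then obtain p where "W.awalk u p v" using W.reachable_awalk by blast
  then have "awalk u p v" by (rule awalk_subgraph[rotated -1]) auto
  then show ?thesis using reachable_awalk by blast
qed

lemma without_ring_step:
  assumes "u \<rightarrow>\<^sup>*\<^bsub>without_ring N\<^esub> tail N e" "e \<in> arcs N" "head N e \<notin> ring_cells N"
  shows "u \<rightarrow>\<^sup>*\<^bsub>without_ring N\<^esub> head N e"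
proof -
  interpret W: fin_digraph "without_ring N" by (rule fin_digraph_without_ring)
  have "W.arc e (tail N e, head N e)" using assms by (simp add: W.arc_def)
  then show ?thesis using assms(1) W.reachable_arc_trans by blast
qed

text \<open>Climb from \<open>v\<close> to the first ring cell: no arc on the way enters the
  ring.\<close>

lemma ring_root_exists:
  assumes "v \<in> verts N"
  obtains r where "r \<in> ring_cells N" "r \<rightarrow>\<^sup>*\<^bsub>without_ring N\<^esub> v"
proof -
  interpret W: fin_digraph "without_ring N" by (rule fin_digraph_without_ring)
  obtain k where "(feeder ^^ k) v \<in> ring_cells N" using reaches_ring assms by blast
  then have "\<exists>r\<in>ring_cells N. r \<rightarrow>\<^sup>*\<^bsub>without_ring N\<^esub> v" using assms
  proof (induction k arbitrary: v)
    case 0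
    then show ?case by (intro bexI[of _ v]) auto
  next
    case (Suc k)
    show ?case
    proof (cases "v \<in> ring_cells N")
      case True
      then show ?thesis using Suc.prems by (intro bexI[of _ v]) auto
    next
      case False
      obtain e where e: "e \<in> arcs N" "head N e = v" "tail N e = feeder v"
        using in_arc_exists Suc.prems(2) by blast
      from Suc.prems(1) have "(feeder ^^ k) (feeder v) \<in> ring_cells N" by (simp add: funpow_swap1)
      with Suc.IH[OF _ feeder_in_verts[OF Suc.prems(2)]]
      obtain r where "r \<in> ring_cells N" "r \<rightarrow>\<^sup>*\<^bsub>without_ring N\<^esub> tail N e" using e by auto
      with without_ring_step[OF this(2) e(1)] e False show ?thesis by auto
    qed
  qed
  with that show ?thesis by blast
qed

end

section \<open>The trees of a one-input graph, their tails and their depth\<close>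

context one_input_graph begin

lemma verts_tree_at [simp]: "verts (tree_at N r) = {v. r \<rightarrow>\<^sup>*\<^bsub>without_ring N\<^esub> v}"
  and tail_tree_at [simp]: "tail (tree_at N r) = tail N"
  and head_tree_at [simp]: "head (tree_at N r) = head N"
  by (simp_all add: tree_at_def)

lemma arcs_tree_at [simp]:
  "arcs (tree_at N r) =
     {e \<in> arcs N. head N e \<notin> ring_cells N \<and> r \<rightarrow>\<^sup>*\<^bsub>without_ring N\<^esub> tail N e}"
  using without_ring_step by (auto simp: tree_at_def)

lemma without_ring_reachable_in_verts: "r \<rightarrow>\<^sup>*\<^bsub>without_ring N\<^esub> v \<Longrightarrow> v \<in> verts N"
  using without_ring_reachable_imp reachable_in_verts(2) by blast

lemma arborescence_tree_at:
  assumes "r \<in> ring_cells N"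
  shows "arborescence (tree_at N r) r"
proof -
  interpret W: fin_digraph "without_ring N" by (rule fin_digraph_without_ring)
  have fin: "finite (verts (tree_at N r))"
    by (rule finite_subset[OF _ finite_verts]) (auto dest: without_ring_reachable_in_verts)
  have "r \<rightarrow>\<^sup>*\<^bsub>without_ring N\<^esub> r" using assms ring_cells_in_verts by auto
  moreover have "inj_on (head N) (arcs (tree_at N r))"
    using in_arc_unique by (auto intro: inj_onI)
  moreover have "r \<rightarrow>\<^sup>*\<^bsub>tree_at N r\<^esub> v" if "v \<in> verts (tree_at N r)" for v
    using W.induce_reachable_preserves_paths[of r v] that by (simp add: tree_at_def)
  ultimately show ?thesis
    using fin assms without_ring_step
    by unfold_locales (auto simp del: verts_tree_at simp: verts_tree_at[of r])
qed

text \<open>No arc of the graph without ring arcs enters the ring, so a tree meets the ring in its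
  root only.\<close>

lemma tree_at_root_unique:
  assumes "r \<rightarrow>\<^sup>*\<^bsub>without_ring N\<^esub> v" "v \<in> ring_cells N"
  shows "v = r"
proof -
  interpret W: fin_digraph "without_ring N" by (rule fin_digraph_without_ring)
  obtain p where p: "W.awalk r p v" using assms(1) W.reachable_awalk by blast
  show ?thesis
  proof (cases p rule: rev_cases)
    case Nil
    with p show ?thesis by (simp add: W.awalk_Nil_iff)
  next
    case (snoc q e)
    with p have "e \<in> arcs (without_ring N)" "head N e = v"
      by (auto simp: W.awalk_snoc_iff simp del: W.awalk_append_iff)
    with assms(2) show ?thesis by simp
  qed
qed

lemma tree_at_root_has_child:
  assumes "arcs (tree_at N r) \<noteq> {}"
  obtains e where "e \<in> arcs (tree_at N r)" "tail N e = r"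
proof -
  interpret W: fin_digraph "without_ring N" by (rule fin_digraph_without_ring)
  obtain e where e: "e \<in> arcs N" "head N e \<notin> ring_cells N" "r \<rightarrow>\<^sup>*\<^bsub>without_ring N\<^esub> tail N e"
    using assms by auto
  from e(3) show ?thesis
  proof (cases rule: W.converse_reachable_cases)
    case base
    with e that show ?thesis by auto
  next
    case (step w)
    then obtain f where "f \<in> arcs (without_ring N)" "tail N f = r" by auto
    moreover from this have "r \<rightarrow>\<^sup>*\<^bsub>without_ring N\<^esub> r" using ring_cells_in_verts by auto
    ultimately show ?thesis using that by auto
  qed
qed

lemma without_ring_walk_unique:
  assumes "r \<in> ring_cells N" "r' \<in> ring_cells N"
    and "pre_digraph.awalk (without_ring N) r p v" "pre_digraph.awalk (without_ring N) r' q v"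
  shows "p = q"
proof -
  interpret W: fin_digraph "without_ring N" by (rule fin_digraph_without_ring)
  show ?thesis
  proof (rule W.awalk_from_source_unique[OF _ _ _ assms(3,4)])
    show "inj_on (head (without_ring N)) (arcs (without_ring N))"
      using inj_head by (auto intro: inj_on_subset)
  qed (use assms(1,2) in auto)
qed

lemma network_tree_has_arc: "T \<in> network_trees N \<Longrightarrow> arcs T \<noteq> {}"
  by (auto simp: network_trees_def)

lemma network_treesE:
  assumes "T \<in> network_trees N"
  obtains r where "r \<in> ring_cells N" "T = tree_at N r" "arborescence T r" "arcs T \<noteq> {}"
  using assms arborescence_tree_at unfolding network_trees_def by blast

lemma tree_at_in_network_trees:
  assumes "r \<in> ring_cells N" "r \<rightarrow>\<^sup>*\<^bsub>without_ring N\<^esub> v" "v \<notin> ring_cells N"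
  shows "tree_at N r \<in> network_trees N"
proof -
  interpret W: fin_digraph "without_ring N" by (rule fin_digraph_without_ring)
  from assms(2) have "arcs (tree_at N r) \<noteq> {}"
  proof (cases rule: W.converse_reachable_cases)
    case base
    with assms show ?thesis by simp
  next
    case (step w)
    then obtain f where "f \<in> arcs (without_ring N)" "tail N f = r" by auto
    moreover from this have "r \<rightarrow>\<^sup>*\<^bsub>without_ring N\<^esub> r" by auto
    ultimately have "f \<in> arcs (tree_at N r)" by auto
    then show ?thesis by blast
  qed
  then show ?thesis using assms(1) unfolding network_trees_def by blast
qed

lemma finite_network_trees: "finite (network_trees N)"
proof -
  have "finite (ring_cells N)"
    using ring_cells_in_verts finite_verts by (blast intro: finite_subset)
  moreover have "network_trees N \<subseteq> tree_at N ` ring_cells N" by (auto simp: network_trees_def)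
  ultimately show ?thesis by (blast intro: finite_subset)
qed

text \<open>A ring cell feeds its successor on the ring.\<close>

lemma ring_cell_not_leaf: "v \<in> ring_cells N \<Longrightarrow> v \<notin> leaves N"
proof -
  assume "v \<in> ring_cells N"
  then obtain k where k: "v \<in> verts N" "0 < k" "(feeder ^^ k) v = v" using ring_cells_iff by blast
  then have "feeder ((feeder ^^ (k - 1)) v) = v"
    by (metis Suc_pred' funpow.simps(2) o_apply)
  with in_arc_exists[OF feeder_pow_in_verts[OF k(1)], of "k - 1"]
  obtain e where "e \<in> arcs N" "tail N e = v" by metis
  then show "v \<notin> leaves N" by (auto simp: leaves_iff)
qed

text \<open>A tree of the network has an arc, so its root is not one of its leaves. Its other
  cells lie off the ring, and deleting the ring arcs does not change what they feed.\<close>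

lemma leaves_tree_at:
  assumes "arcs (tree_at N r) \<noteq> {}"
  shows "leaves (tree_at N r) = leaves N \<inter> verts (tree_at N r)"
proof (intro Set.set_eqI iffI)
  fix v assume v: "v \<in> leaves (tree_at N r)"
  obtain f where f: "f \<in> arcs (tree_at N r)" "tail N f = r"
    using tree_at_root_has_child assms by blast
  then have "v \<noteq> r" using v by (auto simp: leaves_iff)
  then have nr: "v \<notin> ring_cells N" using v tree_at_root_unique[of r v] by (auto simp: leaves_iff)
  have "tail N e \<noteq> v" if "e \<in> arcs N" for e
    using that v nr ring_tail[of e] by (auto simp: leaves_iff)
  then show "v \<in> leaves N \<inter> verts (tree_at N r)"
    using v without_ring_reachable_in_verts by (auto simp: leaves_iff)
next
  fix v assume "v \<in> leaves N \<inter> verts (tree_at N r)"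
  then show "v \<in> leaves (tree_at N r)" by (auto simp: leaves_iff)
qed

text \<open>Walks in the graph without ring arcs serve all trees at once, which makes it possible
  to compare tails of different trees.\<close>

lemma network_tails_iff:
  "p \<in> network_tails N \<longleftrightarrow>
     (\<exists>r\<in>ring_cells N. \<exists>l\<in>leaves N. pre_digraph.awalk (without_ring N) r p l)"
proof
  assume "p \<in> network_tails N"
  then obtain T where T: "T \<in> network_trees N" "p \<in> tree_tails T" by (auto simp: network_tails_def)
  from T(1) obtain r where r: "r \<in> ring_cells N" "T = tree_at N r" "arborescence T r" "arcs T \<noteq> {}"
    by (rule network_treesE)
  interpret T: arborescence T r by (rule r)
  from T(2) obtain l where l: "l \<in> leaves T" "T.awalk r p l" by (auto simp: T.tree_tails_eq)
  have "l \<in> leaves N" using l(1) r leaves_tree_at by blast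
  moreover have "pre_digraph.awalk (without_ring N) r p l"
    by (rule awalk_subgraph[OF _ _ _ _ l(2)]) (auto simp: r(2) dest: without_ring_reachable_in_verts)
  ultimately show "\<exists>r\<in>ring_cells N. \<exists>l\<in>leaves N. pre_digraph.awalk (without_ring N) r p l"
    using r(1) by blast
next
  interpret W: fin_digraph "without_ring N" by (rule fin_digraph_without_ring)
  assume "\<exists>r\<in>ring_cells N. \<exists>l\<in>leaves N. pre_digraph.awalk (without_ring N) r p l"
  then obtain r l where r: "r \<in> ring_cells N" and l: "l \<in> leaves N" and p: "W.awalk r p l" by blast
  then have rl: "r \<rightarrow>\<^sup>*\<^bsub>without_ring N\<^esub> l" using W.reachable_awalk by blast
  with r l ring_cell_not_leaf have T: "tree_at N r \<in> network_trees N"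
    using tree_at_in_network_trees by blast
  interpret T: arborescence "tree_at N r" r using r by (rule arborescence_tree_at)
  obtain q where q: "T.awalk r q l" using rl T.awalk_from_root_exists[of l] by auto
  have "W.awalk r q l"
    by (rule awalk_subgraph[OF _ _ _ _ q]) (auto dest: without_ring_reachable_in_verts)
  then have "q = p" using p r without_ring_walk_unique by blast
  moreover have "l \<in> leaves (tree_at N r)"
    using l rl leaves_tree_at[of r] network_tree_has_arc[OF T] by simp
  ultimately show "p \<in> network_tails N"
    using T q unfolding network_tails_def T.tree_tails_eq[symmetric] by (auto simp: T.tree_tails_eq intro!: bexI[OF _ T])
qed

lemma tail_leaf_eq:
  assumes "r \<in> ring_cells N" "l \<in> leaves N" "pre_digraph.awalk (without_ring N) r p l"
  shows "tail_leaf N p = l"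
proof -
  interpret W: fin_digraph "without_ring N" by (rule fin_digraph_without_ring)
  show ?thesis
  proof (cases p rule: rev_cases)
    case Nil
    with assms ring_cell_not_leaf show ?thesis by (auto simp: W.awalk_Nil_iff)
  next
    case (snoc q e)
    with assms(3) show ?thesis by (simp add: tail_leaf_def W.awalk_snoc_iff del: W.awalk_append_iff)
  qed
qed

text \<open>A cell without outgoing arc is the end of exactly one walk that starts on the ring and
  uses no ring arc.\<close>

lemma bij_betw_tail_leaf: "bij_betw (tail_leaf N) (network_tails N) (leaves N)"
proof (rule bij_betwI')
  interpret W: fin_digraph "without_ring N" by (rule fin_digraph_without_ring)
  fix p q assume "p \<in> network_tails N" "q \<in> network_tails N"
  then obtain r l r' l' where
    p: "r \<in> ring_cells N" "l \<in> leaves N" "W.awalk r p l" and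
    q: "r' \<in> ring_cells N" "l' \<in> leaves N" "W.awalk r' q l'"
    unfolding network_tails_iff by blast
  have "p = q" if "l = l'"
    using without_ring_walk_unique[OF p(1) q(1) p(3)] q(3) that by simp
  then show "tail_leaf N p = tail_leaf N q \<longleftrightarrow> p = q"
    using tail_leaf_eq[OF p] tail_leaf_eq[OF q] by auto
next
  fix p assume "p \<in> network_tails N"
  then show "tail_leaf N p \<in> leaves N" using tail_leaf_eq unfolding network_tails_iff by metis
next
  interpret W: fin_digraph "without_ring N" by (rule fin_digraph_without_ring)
  fix l assume l: "l \<in> leaves N"
  then obtain r where r: "r \<in> ring_cells N" "r \<rightarrow>\<^sup>*\<^bsub>without_ring N\<^esub> l"
    using ring_root_exists[of l] by (auto simp: leaves_iff)
  then obtain p where p: "W.awalk r p l" using W.reachable_awalk by blast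
  with r l have "p \<in> network_tails N" unfolding network_tails_iff by blast
  with tail_leaf_eq[OF r(1) l p] show "\<exists>p\<in>network_tails N. l = tail_leaf N p" by blast
qed

lemma depth_network_tree_pos:
  assumes "T \<in> network_trees N"
  shows "0 < depth T"
proof -
  obtain r where r: "T = tree_at N r" "arborescence T r" "arcs T \<noteq> {}"
    using assms network_treesE by blast
  interpret T: arborescence T r by (rule r)
  obtain e where "e \<in> arcs T" "tail T e = r"
    using tree_at_root_has_child[of r] r by auto
  then have "T.awalk r [e] (head T e)" using T.root_in_verts by (simp add: T.awalk_simps)
  from T.depth_maximal[OF this] show ?thesis by simp
qed

lemma network_depth_eq_0_iff: "network_depth N = 0 \<longleftrightarrow> ring_cells N = verts N"
proof
  assume ring: "ring_cells N = verts N"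
  have "network_trees N = {}"
  proof (rule ccontr)
    assume "network_trees N \<noteq> {}"
    then obtain T where T: "T \<in> network_trees N" by blast
    then obtain r where "T = tree_at N r" "arcs T \<noteq> {}" by (rule network_treesE)
    then show False using ring by auto
  qed
  then show "network_depth N = 0" by (simp add: network_depth_def)
next
  assume d: "network_depth N = 0"
  have "v \<in> ring_cells N" if v: "v \<in> verts N" for v
  proof (rule ccontr)
    assume nr: "v \<notin> ring_cells N"
    obtain r where r: "r \<in> ring_cells N" "r \<rightarrow>\<^sup>*\<^bsub>without_ring N\<^esub> v"
      using ring_root_exists[OF v] by blast
    with nr have T: "tree_at N r \<in> network_trees N" by (intro tree_at_in_network_trees)
    then have "depth (tree_at N r) \<le> Max (depth ` network_trees N)"
      using finite_network_trees by simp
    with T d depth_network_tree_pos[OF T] show False by (auto simp: network_depth_def split: if_splits)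
  qed
  then show "ring_cells N = verts N" using ring_cells_in_verts by blast
qed

text \<open>Take the end of a longest tail in a tree of depth at least 2. It and its feeder are
  both heads of arcs of the tree, so both lie off the ring.\<close>

lemma network_depth_gt_1:
  assumes "1 < network_depth N"
  obtains v where "v \<in> verts N" "v \<notin> ring_cells N" "feeder v \<notin> ring_cells N"
proof -
  from assms have ne: "network_trees N \<noteq> {}" by (auto simp: network_depth_def)
  have "Max (depth ` network_trees N) \<in> depth ` network_trees N"
    using finite_network_trees ne by (intro Max_in) auto
  with assms ne obtain T where T: "T \<in> network_trees N" "1 < depth T"
    by (auto simp: network_depth_def)
  obtain r where r: "T = tree_at N r" "arborescence T r"
    using network_treesE[OF T(1)] by blast
  interpret T: arborescence T r by (rule r)
  obtain p v where p: "T.awalk r p v" "1 < length p"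
    using T.depth_attained T(2) by metis
  obtain q e where q: "p = q @ [e]" "q \<noteq> []" using p(2) by (cases p rule: rev_cases) auto
  obtain q' f where q': "q = q' @ [f]" using q(2) by (cases q rule: rev_cases) auto
  from p q have e: "T.awalk r q (tail T e)" "e \<in> arcs T" 
    by (simp_all add: T.awalk_snoc_iff del: T.awalk_append_iff)
  with q' have f: "f \<in> arcs T" "head T f = tail T e"
    by (simp_all add: T.awalk_snoc_iff del: T.awalk_append_iff)
  from e f r have "e \<in> arcs N" "head N e \<notin> ring_cells N" "tail N e \<notin> ring_cells N" by auto
  with feeder_head[of e] show ?thesis by (intro that[of "head N e"]) auto
qed

end

section \<open>Subtrees closed under descendants\<close>

context one_input_graph begin

text \<open>The cell \<open>x\<close> with everything below it. For \<open>x\<close> on the ring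
  this would contain the whole ring.\<close>

definition offspring :: "'a \<Rightarrow> ('a, 'b) pre_digraph" where
  "offspring x = N \<restriction> {v. x \<rightarrow>\<^sup>* v}"

lemma verts_offspring [simp]: "verts (offspring x) = {v. x \<rightarrow>\<^sup>* v}"
  and tail_offspring [simp]: "tail (offspring x) = tail N"
  and head_offspring [simp]: "head (offspring x) = head N"
  by (simp_all add: offspring_def)

lemma reachable_head: "x \<rightarrow>\<^sup>* tail N e \<Longrightarrow> e \<in> arcs N \<Longrightarrow> x \<rightarrow>\<^sup>* head N e"
  by (rule reachable_arc_trans) (auto simp: arc_def)

lemma arcs_offspring [simp]: "arcs (offspring x) = {e \<in> arcs N. x \<rightarrow>\<^sup>* tail N e}"
  by (auto simp: offspring_def reachable_head)

lemma fin_digraph_offspring: "fin_digraph (offspring x)"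
proof unfold_locales
  show "finite (verts (offspring x))"
    by (rule finite_subset[OF _ finite_verts]) (auto dest: reachable_in_verts(2))
qed (auto intro: reachable_head)

text \<open>An arc from a descendant of \<open>x\<close> into \<open>x\<close> would close a cycle
  and put \<open>x\<close> on the ring.\<close>

lemma arborescence_offspring:
  assumes "x \<in> verts N" "x \<notin> ring_cells N"
  shows "arborescence (offspring x) x"
proof -
  interpret D: fin_digraph "offspring x" by (rule fin_digraph_offspring)
  have "head N e \<noteq> x" if "e \<in> arcs N" "x \<rightarrow>\<^sup>* tail N e" for e
  proof
    assume "head N e = x"
    with that have "x \<rightarrow>\<^sup>+ x"
      using reachable_reachable1_trans[OF that(2)] in_arcs_imp_in_arcs_ends[OF that(1)] by auto
    with assms show False by (simp add: ring_cells_def)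
  qed
  moreover have "inj_on (head N) (arcs (offspring x))"
    using inj_head by (auto intro: inj_on_subset)
  moreover have "x \<rightarrow>\<^sup>*\<^bsub>offspring x\<^esub> v" if "x \<rightarrow>\<^sup>* v" for v
    using induce_reachable_preserves_paths[OF that] by (simp add: offspring_def)
  ultimately show ?thesis using assms(1) by unfold_locales auto
qed

text \<open>Both sides satisfy the same recursion in \<open>k\<close>.\<close>

lemma cells_at_offspring:
  assumes "x \<in> verts N" "x \<notin> ring_cells N"
  shows "cells_at (offspring x) k = {v \<in> verts N. (feeder ^^ k) v = x}"
proof (induction k)
  interpret D: arborescence "offspring x" x by (rule arborescence_offspring[OF assms])
  case 0
  then show ?case using assms(1) by (auto simp: D.cells_at_0)
next
  interpret D: arborescence "offspring x" x by (rule arborescence_offspring[OF assms])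
  case (Suc k)
  have "v \<in> head N ` {e \<in> arcs N. tail N e \<in> verts N \<and> (feeder ^^ k) (tail N e) = x}
      \<longleftrightarrow> v \<in> verts N \<and> (feeder ^^ Suc k) v = x" for v
  proof -
    have eq: "(feeder ^^ Suc k) v = (feeder ^^ k) (feeder v)" by (simp add: funpow_swap1)
    show ?thesis
    proof
      assume "v \<in> head N ` {e \<in> arcs N. tail N e \<in> verts N \<and> (feeder ^^ k) (tail N e) = x}"
      then obtain e where e: "e \<in> arcs N" "v = head N e" "(feeder ^^ k) (tail N e) = x" by blast
      then show "v \<in> verts N \<and> (feeder ^^ Suc k) v = x"
        unfolding eq using feeder_head[OF e(1)] by simp
    next
      assume v: "v \<in> verts N \<and> (feeder ^^ Suc k) v = x"
      then obtain e where "e \<in> arcs N" "head N e = v" "tail N e = feeder v"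
        using in_arc_exists by blast
      with v show "v \<in> head N ` {e \<in> arcs N. tail N e \<in> verts N \<and> (feeder ^^ k) (tail N e) = x}"
        unfolding eq using feeder_in_verts[of v] by force
    qed
  qed
  moreover have "x \<rightarrow>\<^sup>* tail N e" if "e \<in> arcs N" "(feeder ^^ k) (tail N e) = x" for e
    using that reachable_iff_feeder_pow by auto
  ultimately show ?case
    by (auto simp: D.cells_at_Suc Suc.IH image_iff)
qed

lemma descendant_closed_offspring: "descendant_closed N (offspring x)"
  by (auto simp: descendant_closed_def)

lemma connected_offspring:
  assumes "x \<in> verts N" "x \<notin> ring_cells N"
  shows "Digraph_Component.connected (offspring x)"
proof -
  interpret D: arborescence "offspring x" x by (rule arborescence_offspring[OF assms])
  interpret S: pair_wf_digraph "mk_symmetric (offspring x)" by (rule D.wellformed_mk_symmetric)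
  have "x \<rightarrow>\<^sup>*\<^bsub>mk_symmetric (offspring x)\<^esub> v" if "x \<rightarrow>\<^sup>* v" for v
    by (rule D.reachable_mk_symmetricI, rule D.reachable_from_root) (use that in simp)
  then have "u \<rightarrow>\<^sup>*\<^bsub>mk_symmetric (offspring x)\<^esub> v" if "x \<rightarrow>\<^sup>* u" "x \<rightarrow>\<^sup>* v" for u v
    using that by (meson S.reachable_trans symmetric_reachable symmetric_mk_symmetric)
  then show ?thesis using assms(1)
    unfolding Digraph_Component.connected_def strongly_connected_def by auto
qed

text \<open>Off the ring, reachability does not use ring arcs; hence the offspring of
  \<open>x\<close> lies in the tree that contains \<open>x\<close>.\<close>

lemma offspring_in_network_subtrees:
  assumes "x \<in> verts N" "x \<notin> ring_cells N"
  shows "offspring x \<in> network_subtrees N"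
proof -
  interpret D: fin_digraph "offspring x" by (rule fin_digraph_offspring)
  obtain r where r: "r \<in> ring_cells N" "r \<rightarrow>\<^sup>*\<^bsub>without_ring N\<^esub> x"
    using ring_root_exists assms(1) .
  interpret T: arborescence "tree_at N r" r by (rule arborescence_tree_at) (rule r)
  have sub: "r \<rightarrow>\<^sup>*\<^bsub>without_ring N\<^esub> v" if "x \<rightarrow>\<^sup>* v" for v
    using that
  proof (induction rule: reachable_induct)
    case base
    then show ?case using r by simp
  next
    case (step u v)
    then obtain e where e: "e \<in> arcs N" "tail N e = u" "head N e = v" by auto
    with step have "x \<rightarrow>\<^sup>* v" using reachable_head by auto
    then have "v \<notin> ring_cells N" using assms(2) reachable_from_non_ring by blast
    with step.IH e show ?case using without_ring_step by blast
  qed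
  have "subgraph (offspring x) (tree_at N r)"
    using sub assms(2) reachable_from_non_ring reachable_head
    by (intro subgraphI D.wf_digraph T.wf_digraph) (auto simp: compatible_def)
  then show ?thesis
    using connected_offspring[OF assms] tree_at_in_network_trees[OF r assms(2)]
    by (auto simp: network_subtrees_def subtrees_def)
qed

text \<open>The subtree \<open>B\<close> avoids the ring, since it would otherwise contain a ring
  arc. Climbing from any of its cells towards the ring one therefore leaves \<open>B\<close>; let
  \<open>x\<close> be the last cell in \<open>B\<close>. Closure under descendants puts the
  offspring of \<open>x\<close> into \<open>B\<close>. Conversely, the offspring of
  \<open>x\<close> cannot be left along an arc of \<open>B\<close> in either direction: going up
  from a descendant of \<open>x\<close> leads to another descendant, except from \<open>x\<close>
  itself, whose feeder is not in \<open>B\<close>. As \<open>B\<close> is connected, it is the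
  offspring of \<open>x\<close>.\<close>

lemma descendant_closed_subtree_is_offspring:
  assumes B: "B \<in> network_subtrees N" "descendant_closed N B"
  obtains x where "x \<in> verts N" "x \<notin> ring_cells N" "B = offspring x"
proof -
  obtain T where T: "T \<in> network_trees N" "subgraph B T" "Digraph_Component.connected B"
    using B(1) by (auto simp: network_subtrees_def subtrees_def)
  obtain r where r: "T = tree_at N r" using network_treesE T(1) by metis
  have BT: "verts B \<subseteq> verts T" "arcs B \<subseteq> arcs T" "tail B = tail N" "head B = head N"
    and wfB: "wf_digraph B"
    using T(2) r by (auto simp: subgraph_def compatible_def)
  interpret B: wf_digraph B by (rule wfB)
  have vB: "v \<in> verts N" if "v \<in> verts B" for v
    using that BT(1) r by (auto dest: without_ring_reachable_in_verts)
  have aB: "arcs B = {e \<in> arcs N. tail N e \<in> verts B}"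
  proof (intro Set.set_eqI iffI)
    fix e assume e: "e \<in> arcs B"
    then have "tail B e \<in> verts B" by (rule B.tail_in_verts)
    then show "e \<in> {e \<in> arcs N. tail N e \<in> verts B}" using e BT(2,3) r by auto
  next
    fix e assume "e \<in> {e \<in> arcs N. tail N e \<in> verts B}"
    then have "e \<in> out_arcs N (tail N e)" "tail N e \<in> verts B" by simp_all
    then show "e \<in> arcs B" using B(2) unfolding descendant_closed_def by blast
  qed
  have non_ring: "v \<notin> ring_cells N" if v: "v \<in> verts B" for v
  proof
    assume ring: "v \<in> ring_cells N"
    then obtain k where k: "0 < k" "(feeder ^^ k) v = v" using ring_cells_iff by blast
    define u where "u = (feeder ^^ (k - 1)) v"
    have u: "u \<in> ring_cells N" "feeder u = v" "u \<in> verts N"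
      using k ring feeder_pow_ring ring_cells_in_verts
      by (auto simp: u_def gr0_conv_Suc)
    obtain e where "e \<in> arcs N" "head N e = u" "tail N e = v" using in_arc_exists[OF u(3)] u(2) by metis
    then have "e \<in> arcs T" "head N e \<in> ring_cells N" using v aB BT(2) u(1) by auto
    then show False using r by simp
  qed
  obtain v where v: "v \<in> verts B"
    using T(3) by (auto simp: Digraph_Component.connected_def strongly_connected_def)
  obtain k where "(feeder ^^ k) v \<in> ring_cells N" using reaches_ring vB v by blast
  then have "\<exists>k. (feeder ^^ k) v \<notin> verts B" using non_ring by blast
  then have least: "(feeder ^^ (LEAST k. (feeder ^^ k) v \<notin> verts B)) v \<notin> verts B"
    by (rule LeastI_ex)
  then obtain j where j: "(LEAST k. (feeder ^^ k) v \<notin> verts B) = Suc j"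
    using v by (cases "LEAST k. (feeder ^^ k) v \<notin> verts B") auto
  define x where "x = (feeder ^^ j) v"
  have "\<not> (feeder ^^ j) v \<notin> verts B" using j by (intro not_less_Least) simp
  then have x: "x \<in> verts B" by (simp add: x_def)
  have top: "feeder x \<notin> verts B" using least j by (simp add: x_def)
  have down: "u \<in> verts B" if "x \<rightarrow>\<^sup>* u" for u
    using that
  proof (induction rule: reachable_induct)
    case base
    show ?case by (rule x)
  next
    case (step u w)
    then obtain e where "e \<in> arcs N" "tail N e = u" "head N e = w" by auto
    with step have "e \<in> arcs B" "head B e = w" using aB BT(4) by auto
    then show ?case using B.head_in_verts by blast
  qed
  have up: "x \<rightarrow>\<^sup>* u" if "u \<in> verts B" for u
  proof -
    have "x \<rightarrow>\<^sup>*\<^bsub>mk_symmetric B\<^esub> u"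
      using T(3) x that by (auto simp: Digraph_Component.connected_def strongly_connected_def)
    then have "(x, u) \<in> (parcs (mk_symmetric B))\<^sup>*" by (auto dest: reachable_rtranclI)
    then show ?thesis
    proof (induction rule: rtrancl_induct)
      case base
      then show ?case using x vB by simp
    next
      case (step y z)
      from step(2) obtain e where e: "e \<in> arcs B"
        "tail N e = y \<and> head N e = z \<or> tail N e = z \<and> head N e = y"
        by (auto simp: parcs_mk_symmetric BT)
      then have eN: "e \<in> arcs N" "tail N e \<in> verts B" using aB by auto
      from e(2) show ?case
      proof
        assume "tail N e = y \<and> head N e = z"
        then show ?thesis using step.IH eN reachable_head[of x e] by auto
      next
        assume e': "tail N e = z \<and> head N e = y"
        then have fz: "feeder y = z" using feeder_head[OF eN(1)] by simp
        from step.IH obtain i where i: "(feeder ^^ i) y = x" using reachable_iff_feeder_pow by blast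
        show ?thesis
        proof (cases i)
          case 0
          with i fz top eN(2) e' show ?thesis by auto
        next
          case (Suc i')
          with i fz have "(feeder ^^ i') z = x" by (simp add: funpow_swap1)
          then show ?thesis using eN e' vB reachable_iff_feeder_pow by auto
        qed
      qed
    qed
  qed
  have "verts B = {u. x \<rightarrow>\<^sup>* u}" using up down by blast
  then have "B = offspring x" using aB BT by (intro pre_digraph.equality) auto
  then show ?thesis using x vB non_ring by (intro that[of x]) auto
qed

lemma descendant_closed_subtrees_eq:
  "{B \<in> network_subtrees N. descendant_closed N B} = offspring ` (verts N - ring_cells N)"
  using descendant_closed_subtree_is_offspring offspring_in_network_subtrees descendant_closed_offspring
  by blast

lemma root_offspring: "x \<in> verts N \<Longrightarrow> x \<notin> ring_cells N \<Longrightarrow> root (offspring x) = x"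
  by (rule arborescence.root_eq) (rule arborescence_offspring)

end

section \<open>Preliminaries from linear algebra\<close>

lemma (in vec_space) span_single: "v \<in> carrier_vec n \<Longrightarrow> span {v} = {a \<cdot>\<^sub>v v | a. True}"
proof -
  assume v: "v \<in> carrier_vec n"
  then have "lincomb a {v} = a v \<cdot>\<^sub>v v" for a by (simp add: lincomb_def)
  moreover have "span {v} = {lincomb a {v} | a. a \<in> {v} \<rightarrow> UNIV}" using v by (subst finite_span) auto
  moreover have "\<exists>b. a = b v" for a :: 'a by (rule exI[of _ "\<lambda>_. a"]) simp
  ultimately show ?thesis by auto
qed

text \<open>This describes the kernel of the adjacency matrix, with \<open>K\<close> the set of
  the numbers of the leaves.\<close>

lemma (in vec_space) coordinate_subspace:
  fixes K :: "nat set"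
  defines "W \<equiv> {v \<in> carrier_vec n. \<forall>i<n. i \<notin> K \<longrightarrow> v $ i = 0}"
  assumes K: "K \<subseteq> {..<n}"
  shows "vectorspace class_ring (V\<lparr>carrier := W\<rparr>)"
    and "vectorspace.basis class_ring (V\<lparr>carrier := W\<rparr>) (unit_vec n ` K)"
    and "vectorspace.dim class_ring (V\<lparr>carrier := W\<rparr>) = card K"
proof -
  have fin: "finite K" using K finite_subset by blast
  have sub: "submodule class_ring W V"
    by unfold_locales (auto simp: W_def module_vec_simps class_ring_simps)
  then have "subspace class_ring W V" using vectorspace_axioms by (simp add: subspace_def)
  then show vs: "vectorspace class_ring (V\<lparr>carrier := W\<rparr>)" by (rule subspace_is_vs)
  interpret W: vectorspace class_ring "V\<lparr>carrier := W\<rparr>" by (rule vs)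
  have UW: "unit_vec n ` K \<subseteq> W" using K by (auto simp: W_def)
  have UV: "unit_vec n ` K \<subseteq> carrier_vec n" by auto
  have inj: "inj_on (unit_vec n :: nat \<Rightarrow> 'a vec) K"
  proof (rule inj_onI)
    fix i j assume ij: "i \<in> K" "j \<in> K" "unit_vec n i = (unit_vec n j :: 'a vec)"
    then have "unit_vec n i $ i = (unit_vec n j $ i :: 'a)" by simp
    with ij K show "i = j" by (auto split: if_splits)
  qed
  have "v \<in> span (unit_vec n ` K)" if v: "v \<in> W" for v
  proof -
    define a where "a = (\<lambda>u. v \<bullet> u)"
    have vc: "v \<in> carrier_vec n" using v by (simp add: W_def)
    have "lincomb a (unit_vec n ` K) = v"
    proof (rule eq_vecI)
      fix i assume "i < dim_vec v"
      then have i: "i < n" using vc by simp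
      have "lincomb a (unit_vec n ` K) $ i = (\<Sum>k\<in>K. a (unit_vec n k) * unit_vec n k $ i)"
        by (simp add: lincomb_index[OF i UV] sum.reindex[OF inj])
      also have "\<dots> = (\<Sum>k\<in>K. if k = i then v $ i else 0)"
        using K vc i by (intro sum.cong) (auto simp: a_def)
      also have "\<dots> = v $ i" using fin v i by (auto simp: W_def sum.delta)
      finally show "lincomb a (unit_vec n ` K) $ i = v $ i" .
    qed (use vc fin lincomb_dim[OF _ UV] in auto)
    then show ?thesis using fin UV by (subst finite_span) auto
  qed
  then have span: "span (unit_vec n ` K) = W"
    using span_is_subset[OF UW sub] by blast
  have "unit_vec n ` K \<subseteq> set (unit_vecs n)" using K by (auto simp: unit_vecs_def)
  then have "lin_indpt (unit_vec n ` K)"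
    using unit_vecs_basis subset_li_is_li unfolding basis_def by blast
  then show basis: "W.basis (unit_vec n ` K)"
    unfolding W.basis_def span_li_not_depend[OF UW sub] span using UW by simp
  show "W.dim = card K"
    using W.dim_basis[OF _ basis] fin card_image[OF inj] by simp
qed

lemma char_poly_four_block_upper_right_zero:
  fixes A1 :: "'k::idom mat"
  assumes A1: "A1 \<in> carrier_mat k k" and A3: "A3 \<in> carrier_mat l k" and A4: "A4 \<in> carrier_mat l l"
  shows "char_poly (four_block_mat A1 (0\<^sub>m k l) A3 A4) = char_poly A1 * char_poly A4"
proof -
  have "char_poly_matrix (four_block_mat A1 (0\<^sub>m k l) A3 A4) =
      four_block_mat (char_poly_matrix A1) (0\<^sub>m k l) (map_mat (\<lambda>a. [:- a:]) A3) (char_poly_matrix A4)"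
    using A1 A3 A4 by (intro eq_matI) (auto simp: char_poly_matrix_def)
  then show ?thesis
    unfolding char_poly_def
    using det_four_block_mat_upper_right_zero[of "char_poly_matrix A1" k "0\<^sub>m k l" l
        "map_mat (\<lambda>a. [:- a:]) A3" "char_poly_matrix A4"] A1 A3 A4 by simp
qed

lemma char_poly_strictly_lower_triangular:
  fixes L :: "'k::idom mat"
  assumes L: "L \<in> carrier_mat l l" and zero: "\<And>i j. i \<le> j \<Longrightarrow> j < l \<Longrightarrow> L $$ (i, j) = 0"
  shows "char_poly L = [:0, 1:] ^ l"
proof -
  have "upper_triangular (transpose_mat L)"
    using L zero by (auto simp: upper_triangular_def)
  then have "char_poly (transpose_mat L) = (\<Prod>a\<leftarrow>diag_mat (transpose_mat L). [:- a, 1:])"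
    using L by (intro char_poly_upper_triangular) auto
  moreover have "diag_mat (transpose_mat L) = replicate l 0"
    using L zero by (auto simp: diag_mat_def list_eq_iff_nth_eq)
  ultimately show ?thesis using L by (simp add: prod_list_replicate)
qed

text \<open>Diagonalizable matrices have no Jordan chain of length 2 for the eigenvalue 0: for a
  diagonal matrix \<open>d\<^sup>2 y = 0\<close> forces \<open>d y = 0\<close> entry by
  entry.\<close>

lemma kernel_square_diagonalizable:
  fixes A :: "'k::field mat"
  assumes A: "A \<in> carrier_mat n n" and diag: "diagonalizable A"
    and x: "x \<in> carrier_vec n" and "A *\<^sub>v (A *\<^sub>v x) = 0\<^sub>v n"
  shows "A *\<^sub>v x = 0\<^sub>v n"
proof -
  obtain D where D: "similar_mat A D" "diagonal_mat D" using diag unfolding diagonalizable_def by blast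
  then obtain P Q where "similar_mat_wit A D P Q" unfolding similar_mat_def by blast
  note wit = similar_mat_witD2[OF A this]
  have car: "P \<in> carrier_mat n n" "Q \<in> carrier_mat n n" "D \<in> carrier_mat n n" using wit by auto
  define y where "y = Q *\<^sub>v x"
  have y: "y \<in> carrier_vec n" using car x by (simp add: y_def)
  have QA: "Q *\<^sub>v (A *\<^sub>v z) = D *\<^sub>v (Q *\<^sub>v z)" if z: "z \<in> carrier_vec n" for z
  proof -
    have "Q * A = Q * (P * D * Q)" using wit by simp
    also have "\<dots> = (Q * P) * (D * Q)" using car by (simp add: assoc_mult_mat[of _ n n _ n _ n])
    also have "\<dots> = D * Q" using wit car by simp
    finally show ?thesis using car A z by (metis assoc_mult_mat_vec)
  qed
  have Dv: "(D *\<^sub>v z) $ i = D $$ (i, i) * z $ i" if "z \<in> carrier_vec n" "i < n" for z i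
  proof -
    have "(D *\<^sub>v z) $ i = (\<Sum>j<n. D $$ (i, j) * z $ j)"
      using that car by (simp add: scalar_prod_def lessThan_atLeast0)
    also have "\<dots> = (\<Sum>j<n. if j = i then D $$ (i, i) * z $ i else 0)"
      using D(2) that car by (intro sum.cong) (auto simp: diagonal_mat_def)
    finally show ?thesis using that by simp
  qed
  have mult_0: "M *\<^sub>v 0\<^sub>v n = 0\<^sub>v n" if "M \<in> carrier_mat n n" for M :: "'k mat"
    using that by (intro eq_vecI) auto
  have "D *\<^sub>v (D *\<^sub>v y) = Q *\<^sub>v (A *\<^sub>v (A *\<^sub>v x))" using QA x A by (simp add: y_def)
  also have "\<dots> = 0\<^sub>v n" using assms(4) car mult_0 by simp
  finally have "D $$ (i, i) * (D $$ (i, i) * y $ i) = 0" if "i < n" for i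
    using Dv[OF _ that, of "D *\<^sub>v y"] Dv[OF y that] car y that by simp
  then have "D *\<^sub>v y = 0\<^sub>v n" using Dv[OF y] car by (intro eq_vecI) auto
  then have "Q *\<^sub>v (A *\<^sub>v x) = 0\<^sub>v n" using QA[OF x] by (simp add: y_def)
  then have "P *\<^sub>v (Q *\<^sub>v (A *\<^sub>v x)) = 0\<^sub>v n" using car mult_0 by simp
  moreover have "P *\<^sub>v (Q *\<^sub>v (A *\<^sub>v x)) = (P * Q) *\<^sub>v (A *\<^sub>v x)"
    using car A x by (simp add: assoc_mult_mat_vec[of _ n n _ n])
  moreover have "P * Q = 1\<^sub>m n" using wit by simp
  moreover have "1\<^sub>m n *\<^sub>v (A *\<^sub>v x) = A *\<^sub>v x" using A x by (intro one_mult_mat_vec) simp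
  ultimately show ?thesis by simp
qed

lemma finsum_unit_vec:
  assumes "S \<subseteq> {..<n}"
  shows "finsum_vec TYPE('k::semiring_1) n (unit_vec n) S = vec n (\<lambda>i. if i \<in> S then 1 else 0)"
proof -
  have fin: "finite S" using assms finite_subset by blast
  show ?thesis
  proof (rule eq_vecI)
    fix i assume "i < dim_vec (vec n (\<lambda>i. if i \<in> S then 1 else 0) :: 'k vec)"
    then have i: "i < n" by simp
    have "finsum_vec TYPE('k) n (unit_vec n) S $ i = (\<Sum>k\<in>S. unit_vec n k $ i)"
      by (rule index_finsum_vec[OF fin i]) auto
    also have "\<dots> = (\<Sum>k\<in>S. if k = i then 1 else 0)"
      using assms i by (intro sum.cong) auto
    finally show "finsum_vec TYPE('k) n (unit_vec n) S $ i = vec n (\<lambda>i. if i \<in> S then 1 else 0) $ i"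
      using fin i by simp
  next
    have "finsum_vec TYPE('k) n (unit_vec n) S \<in> carrier_vec n"
      by (rule finsum_vec_closed) auto
    then show "dim_vec (finsum_vec TYPE('k) n (unit_vec n) S) =
        dim_vec (vec n (\<lambda>i. if i \<in> S then 1 else 0) :: 'k vec)" by simp
  qed
qed

lemma root_of_unity_eq_cis: "root_of_unity m j = cis (2 * pi * real j / real m)"
  by (simp add: root_of_unity_def cis_conv_exp field_simps)

lemma roots_of_unity: "0 < m \<Longrightarrow> root_of_unity m ` {..<m} = {z. z ^ m = 1}"
  using bij_betw_roots_unity[of m] by (simp add: root_of_unity_eq_cis bij_betw_def)

section \<open>Pullback along a ring with trees attached\<close>

text \<open>The matrix of \<open>v \<mapsto> v \<circ> \<pi>\<close>.\<close>

definition pullback_mat :: "nat \<Rightarrow> (nat \<Rightarrow> nat) \<Rightarrow> 'k::semiring_1 mat" where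
  "pullback_mat n \<pi> = mat n n (\<lambda>(i, j). if j = \<pi> i then 1 else 0)"

lemma pullback_mat_carrier [simp]: "pullback_mat n \<pi> \<in> carrier_mat n n"
  by (simp add: pullback_mat_def)

lemma dim_pullback_mat [simp]:
  "dim_row (pullback_mat n \<pi>) = n" "dim_col (pullback_mat n \<pi>) = n"
  by (simp_all add: pullback_mat_def)

lemma pullback_mat_mult_vec:
  assumes "\<And>i. i < n \<Longrightarrow> \<pi> i < n" and v: "v \<in> carrier_vec n"
  shows "pullback_mat n \<pi> *\<^sub>v v = vec n (\<lambda>i. v $ \<pi> i)"
proof (rule eq_vecI)
  fix i assume "i < dim_vec (vec n (\<lambda>i. v $ \<pi> i))"
  then have i: "i < n" by simp
  then have "(pullback_mat n \<pi> *\<^sub>v v) $ i = (\<Sum>j<n. (if j = \<pi> i then 1 else 0) * v $ j)"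
    using v by (simp add: pullback_mat_def scalar_prod_def lessThan_atLeast0)
  also have "\<dots> = (\<Sum>j<n. if j = \<pi> i then v $ \<pi> i else 0)" by (intro sum.cong) auto
  also have "\<dots> = v $ \<pi> i" using assms(1)[OF i] by simp
  finally show "(pullback_mat n \<pi> *\<^sub>v v) $ i = vec n (\<lambda>i. v $ \<pi> i) $ i" using i by simp
qed simp

text \<open>A ring of \<open>m\<close> points with trees attached, each point being mapped towards
  the ring. Off the ring the points are numbered so that the map decreases numbers.\<close>

locale ring_with_trees =
  fixes \<pi> :: "nat \<Rightarrow> nat" and m n :: nat
  assumes m_pos: "0 < m" and m_le_n: "m \<le> n"
    and ring: "i < m \<Longrightarrow> \<pi> i = Suc i mod m"
    and tree: "m \<le> i \<Longrightarrow> i < n \<Longrightarrow> \<pi> i < i"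
begin

lemma ring_closed: "i < m \<Longrightarrow> \<pi> i < m"
  using ring m_pos by simp

lemma map_less: "i < n \<Longrightarrow> \<pi> i < n"
  using ring_closed[of i] tree[of i] m_le_n by (cases "i < m") auto

lemma pow_less: "i < n \<Longrightarrow> (\<pi> ^^ k) i < n"
  by (induction k) (auto intro: map_less)

lemma pow_ring: "i < m \<Longrightarrow> (\<pi> ^^ k) i = (i + k) mod m"
proof (induction k)
  case (Suc k)
  then have "(\<pi> ^^ Suc k) i = Suc ((i + k) mod m) mod m" using ring m_pos by simp
  then show ?case by (simp add: mod_Suc_eq)
qed simp

text \<open>Each step off the ring lowers the number, so that the ring is reached in fewer than
  \<open>n\<close> steps.\<close>

lemma pow_descends: "i < n \<Longrightarrow> (\<pi> ^^ k) i < m \<or> (\<pi> ^^ k) i + k \<le> i"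
proof (induction k)
  case (Suc k)
  show ?case
  proof (cases "(\<pi> ^^ k) i < m")
    case True
    then show ?thesis using ring_closed by simp
  next
    case False
    then show ?thesis using Suc tree[of "(\<pi> ^^ k) i"] pow_less[OF Suc.prems, of k] by simp
  qed
qed simp

text \<open>The point of the ring that is reached after \<open>n * m\<close> steps. This is late
  enough for every point to be on the ring, and a multiple of \<open>m\<close>, so that ring
  points return to themselves. The phase is thus a retraction onto the ring that commutes with
  \<open>\<pi>\<close>.\<close>

definition phase :: "nat \<Rightarrow> nat" where
  "phase = \<pi> ^^ (n * m)"

lemma phase_less: 
  assumes "i < n"
  shows "phase i < m"
proof -
  have "i < n * m" using assms m_pos by (cases m) auto
  then show ?thesis using pow_descends[OF assms, of "n * m"] by (auto simp: phase_def)
qed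

lemma phase_ring: "i < m \<Longrightarrow> phase i = i"
  by (simp add: phase_def pow_ring)

lemma phase_map: "i < n \<Longrightarrow> phase (\<pi> i) = Suc (phase i) mod m"
  using ring[OF phase_less] by (simp add: phase_def funpow_swap1)

abbreviation A :: "'k::semiring_1 mat" where
  "A \<equiv> pullback_mat n \<pi>"

lemma A_mult_vec: "v \<in> carrier_vec n \<Longrightarrow> A *\<^sub>v v = vec n (\<lambda>i. v $ \<pi> i)"
  by (rule pullback_mat_mult_vec[OF map_less])

lemma eigen_pow:
  fixes v :: "'k::field vec"
  assumes v: "v \<in> carrier_vec n" and e: "A *\<^sub>v v = k \<cdot>\<^sub>v v" and i: "i < n"
  shows "v $ (\<pi> ^^ l) i = k ^ l * v $ i"
proof (induction l)
  case (Suc l)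
  have "(A *\<^sub>v v) $ (\<pi> ^^ l) i = k * v $ (\<pi> ^^ l) i"
    unfolding e using v pow_less[OF i] by simp
  then have "v $ (\<pi> ^^ Suc l) i = k * v $ (\<pi> ^^ l) i"
    using A_mult_vec[OF v] pow_less[OF i] by simp
  with Suc show ?case by simp
qed simp

text \<open>For \<open>k\<^sup>m = 1\<close>, the eigenvector \<open>(1, k, k\<^sup>2,
  \<dots>)\<close> of the ring, extended along the phase.\<close>

definition wave :: "'k::field \<Rightarrow> 'k vec" where
  "wave k = vec n (\<lambda>i. k ^ phase i)"

lemma wave_carrier [simp]: "wave k \<in> carrier_vec n"
  by (simp add: wave_def)

lemma power_mod: "k ^ m = (1::'k::field) \<Longrightarrow> k ^ (i mod m) = k ^ i"
  by (metis mod_mult_div_eq power_add power_mult power_one mult.right_neutral)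

lemma wave_eigen:
  fixes k :: "'k::field"
  assumes "k ^ m = 1"
  shows "A *\<^sub>v wave k = k \<cdot>\<^sub>v wave k"
  unfolding A_mult_vec[OF wave_carrier]
  using phase_map map_less power_mod[OF assms] by (intro eq_vecI) (auto simp: wave_def)

lemma wave_eigenvector:
  fixes k :: "'k::field"
  assumes "k ^ m = 1"
  shows "eigenvector A (wave k) k"
proof -
  have "wave k $ 0 = 1" using m_pos m_le_n phase_ring[of 0] by (simp add: wave_def)
  then have "wave k \<noteq> 0\<^sub>v n" using m_pos m_le_n by auto
  then show ?thesis using wave_eigen[OF assms] by (simp add: eigenvector_def)
qed

text \<open>The value at \<open>i\<close> equals the value at the phase of \<open>i\<close>,
  because \<open>k ^ (n * m) = 1\<close>, and the phase is reached from point 0 along the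
  ring.\<close>

lemma eigenspace_root_of_unity:
  fixes k :: "'k::field"
  assumes "k ^ m = 1"
  shows "eigenspace A k = {a \<cdot>\<^sub>v wave k | a. True}"
proof (intro Set.set_eqI iffI)
  fix v assume "v \<in> eigenspace A k"
  then have v: "v \<in> carrier_vec n" "A *\<^sub>v v = k \<cdot>\<^sub>v v" by (simp_all add: eigenspace_def)
  have 0: "0 < n" using m_pos m_le_n by simp
  have "v $ i = v $ 0 * k ^ phase i" if i: "i < n" for i
  proof -
    have "v $ phase i = k ^ (n * m) * v $ i" using eigen_pow[OF v i] by (simp add: phase_def)
    also have "k ^ (n * m) = 1" using assms by (simp add: power_mult mult.commute[of n])
    finally have "v $ i = v $ phase i" by simp
    also have "phase i = (\<pi> ^^ phase i) 0" using pow_ring[OF m_pos] phase_less[OF i] by simp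
    also have "v $ (\<pi> ^^ phase i) 0 = k ^ phase i * v $ 0" by (rule eigen_pow[OF v 0])
    finally show ?thesis by simp
  qed
  note coord = this
  have "v = v $ 0 \<cdot>\<^sub>v wave k"
  proof (rule eq_vecI)
    fix i assume "i < dim_vec (v $ 0 \<cdot>\<^sub>v wave k)"
    then have "i < n" by (simp add: wave_def)
    from coord[OF this] this show "v $ i = (v $ 0 \<cdot>\<^sub>v wave k) $ i" by (simp add: wave_def)
  qed (use v(1) in \<open>simp add: wave_def\<close>)
  then show "v \<in> {a \<cdot>\<^sub>v wave k | a. True}" by blast
next
  fix v assume "v \<in> {a \<cdot>\<^sub>v wave k | a. True}"
  then obtain a where v: "v = a \<cdot>\<^sub>v wave k" by blast
  have "A *\<^sub>v v = a \<cdot>\<^sub>v (A *\<^sub>v wave k)"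
    unfolding v by (rule mult_mat_vec) auto
  then show "v \<in> eigenspace A k"
    using v wave_eigen[OF assms] by (simp add: eigenspace_def smult_smult_assoc mult.commute)
qed

text \<open>If \<open>k\<^sup>m \<noteq> 1\<close> then the eigenvector vanishes on the ring,
  where \<open>m\<close> steps lead back to the start; as \<open>k \<noteq> 0\<close>, it then
  vanishes at every point that some power of \<open>\<pi>\<close> maps to the ring.\<close>

lemma nonzero_eigenvalue:
  fixes k :: "'k::field"
  assumes "eigenvalue A k" "k \<noteq> 0"
  shows "k ^ m = 1"
proof (rule ccontr)
  assume k: "k ^ m \<noteq> 1"
  obtain v where v: "v \<in> carrier_vec n" "v \<noteq> 0\<^sub>v n" "A *\<^sub>v v = k \<cdot>\<^sub>v v"
    using assms(1) by (auto simp: eigenvalue_def eigenvector_def)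
  have ring0: "v $ i = 0" if "i < m" for i
  proof -
    have "v $ i = k ^ m * v $ i" using eigen_pow[OF v(1,3), of i m] pow_ring[of i m] that m_le_n by simp
    with k show ?thesis by simp
  qed
  have "v $ i = 0" if i: "i < n" for i
  proof -
    have "v $ phase i = k ^ (n * m) * v $ i" using eigen_pow[OF v(1,3) i] by (simp add: phase_def)
    with ring0[OF phase_less[OF i]] assms(2) show ?thesis by simp
  qed
  then have "v = 0\<^sub>v n" using v(1) by (intro eq_vecI) auto
  with v(2) show False by simp
qed

lemma eigenspace_0:
  "eigenspace (A :: 'k::field mat) 0 =
     {v \<in> carrier_vec n. \<forall>i<n. i \<notin> {..<n} - \<pi> ` {..<n} \<longrightarrow> v $ i = 0}"
proof -
  have "A *\<^sub>v v = 0 \<cdot>\<^sub>v v \<longleftrightarrow> (\<forall>i<n. v $ \<pi> i = 0)" if v: "v \<in> carrier_vec n" for v :: "'k vec"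
    unfolding A_mult_vec[OF v] using v by (auto simp: vec_eq_iff)
  then show ?thesis using map_less by (auto simp: eigenspace_def)
qed

text \<open>The number \<open>n - 1\<close>, if it lies off the ring, is not a value of
  \<open>\<pi>\<close>. Without points off the ring \<open>\<pi>\<close> is onto.\<close>

lemma eigenvalue_0_iff: "eigenvalue (A :: 'k::field mat) 0 \<longleftrightarrow> m < n"
proof
  assume "m < n"
  have "n - 1 \<notin> \<pi> ` {..<n}"
  proof
    assume "n - 1 \<in> \<pi> ` {..<n}"
    then obtain i where i: "i < n" "\<pi> i = n - 1" by auto
    then show False using ring_closed[of i] tree[of i] \<open>m < n\<close> by (cases "i < m") auto
  qed
  then have "unit_vec n (n - 1) \<in> eigenspace (A :: 'k mat) 0"
    unfolding eigenspace_0 by auto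
  moreover have "unit_vec n (n - 1) \<noteq> (0\<^sub>v n :: 'k vec)" using \<open>m < n\<close> by simp
  ultimately show "eigenvalue (A :: 'k mat) 0"
    unfolding eigenvalue_def eigenvector_def eigenspace_def
    by (intro exI[of _ "unit_vec n (n - 1)"]) auto
next
  assume "eigenvalue (A :: 'k mat) 0"
  then obtain v :: "'k vec" where v: "v \<in> eigenspace A 0" "v \<noteq> 0\<^sub>v n"
    by (auto simp: eigenvalue_def eigenvector_def eigenspace_def)
  show "m < n"
  proof (rule ccontr)
    assume "\<not> m < n"
    then have "m = n" using m_le_n by simp
    have "v $ i = 0" if "i < n" for i
    proof -
      \<comment> \<open>the predecessor of \<open>i\<close> on the ring\<close>
      have "\<pi> ((i + (m - 1)) mod m) = Suc (i + (m - 1)) mod m"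
        using ring[of "(i + (m - 1)) mod m"] m_pos by (simp add: mod_Suc_eq)
      also have "\<dots> = i" using that \<open>m = n\<close> by simp
      finally have "i \<in> \<pi> ` {..<n}" using m_pos \<open>m = n\<close> by (metis imageI lessThan_iff mod_less_divisor)
      then show ?thesis using v(1) that unfolding eigenspace_0 by auto
    qed
    then have "v = 0\<^sub>v n" using v(1) unfolding eigenspace_0 by (intro eq_vecI) auto
    with v(2) show False by simp
  qed
qed

lemma spectrum_eq:
  "spectrum (A :: 'k::field mat) = {k. k ^ m = 1} \<union> (if m < n then {0} else {})"
proof (intro Set.set_eqI)
  fix k :: 'k
  have "eigenvalue A k" if "k ^ m = 1" using wave_eigenvector[OF that] unfolding eigenvalue_def by blast
  moreover have "k = 0 \<or> k ^ m = 1" if "eigenvalue A k" using nonzero_eigenvalue[OF that] by blast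
  ultimately show "k \<in> spectrum A \<longleftrightarrow> k \<in> {k. k ^ m = 1} \<union> (if m < n then {0} else {})"
    using eigenvalue_0_iff[where 'k='k] by (auto simp: spectrum_def)
qed

text \<open>In block form the characteristic polynomial is the product of that of the ring, which
  does not vanish at 0, and that of a strictly lower triangular matrix of size \<open>n -
  m\<close>.\<close>

lemma order_0_char_poly: "Polynomial.order 0 (char_poly (A :: 'k::field mat)) = n - m"
proof -
  \<comment> \<open>the ring on its own, with no trees attached\<close>
  interpret R: ring_with_trees \<pi> m m by unfold_locales (use m_pos ring in auto)
  define B :: "'k mat" where "B = mat (n - m) m (\<lambda>(i, j). if j = \<pi> (i + m) then 1 else 0)"
  define L :: "'k mat" where "L = mat (n - m) (n - m) (\<lambda>(i, j). if j + m = \<pi> (i + m) then 1 else 0)"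
  have blocks: "A = four_block_mat R.A (0\<^sub>m m (n - m)) B L"
  proof (rule eq_matI)
    fix i j assume "i < dim_row (four_block_mat R.A (0\<^sub>m m (n - m)) B L)"
      "j < dim_col (four_block_mat R.A (0\<^sub>m m (n - m)) B L)"
    then have "i < n" "j < n" using m_le_n by (auto simp: L_def)
    then show "(A :: 'k mat) $$ (i, j) = four_block_mat R.A (0\<^sub>m m (n - m)) B L $$ (i, j)"
      using ring_closed[of i] by (auto simp: pullback_mat_def B_def L_def)
  qed (use m_le_n in \<open>auto simp: L_def\<close>)
  have "char_poly L = [:0, 1:] ^ (n - m)"
  proof (rule char_poly_strictly_lower_triangular)
    fix i j assume ij: "i \<le> j" "j < n - m"
    then have "\<pi> (i + m) < i + m" by (intro tree) auto
    then show "L $$ (i, j) = 0" using ij by (auto simp: L_def)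
  qed (simp add: L_def)
  then have eq: "char_poly (A :: 'k mat) = char_poly R.A * [:0, 1:] ^ (n - m)"
    unfolding blocks by (subst char_poly_four_block_upper_right_zero) (auto simp: B_def L_def)
  have "poly (char_poly (R.A :: 'k mat)) 0 \<noteq> 0"
    using R.eigenvalue_0_iff[where 'k='k] by (simp add: eigenvalue_root_char_poly[of _ m])
  moreover have "char_poly (A :: 'k mat) \<noteq> 0"
    using degree_monic_char_poly[of "A :: 'k mat" n] by auto
  moreover have "Polynomial.order 0 ([:0, 1:] ^ (n - m) :: 'k poly) = n - m"
    using order_power_n_n[of "0 :: 'k" "n - m"] by simp
  ultimately show ?thesis unfolding eq by (simp add: order_mult order_0I)
qed

text \<open>Choose the largest number \<open>j\<close> off the ring that is a value of
  \<open>\<pi>\<close>. The points mapped to \<open>j\<close> have larger numbers, hence are not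
  values of \<open>\<pi>\<close>. The unit vector at \<open>j\<close> is then annihilated by the
  square of the matrix but not by the matrix.\<close>

lemma not_diagonalizable:
  assumes i: "m \<le> \<pi> i" "i < n"
  shows "\<not> diagonalizable (A :: 'k::field mat)"
proof
  assume diag: "diagonalizable (A :: 'k mat)"
  define J where "J = {j \<in> \<pi> ` {..<n}. m \<le> j}"
  define j where "j = Max J"
  have "finite J" "\<pi> i \<in> J" using i by (auto simp: J_def)
  then have jJ: "j \<in> J" and jmax: "\<And>l. l \<in> J \<Longrightarrow> l \<le> j" unfolding j_def by (auto intro: Max_in)
  then obtain l where l: "l < n" "\<pi> l = j" "m \<le> j" by (auto simp: J_def)
  have jn: "j < n" using l map_less by blast
  define x :: "'k vec" where "x = unit_vec n j"
  have x: "x \<in> carrier_vec n" by (simp add: x_def)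
  have no: "\<pi> (\<pi> k) \<noteq> j" if k: "k < n" for k
  proof
    assume eq: "\<pi> (\<pi> k) = j"
    have "\<not> \<pi> k < m" using ring_closed[of "\<pi> k"] eq l(3) by auto
    then have "\<pi> k \<in> J" "\<pi> (\<pi> k) < \<pi> k" using k tree[of "\<pi> k"] map_less[OF k] by (auto simp: J_def)
    then show False using jmax[of "\<pi> k"] eq by simp
  qed
  have Ax: "A *\<^sub>v x = vec n (\<lambda>k. x $ \<pi> k)" by (rule A_mult_vec[OF x])
  then have "A *\<^sub>v (A *\<^sub>v x) = vec n (\<lambda>k. vec n (\<lambda>k. x $ \<pi> k) $ \<pi> k)"
    using A_mult_vec[of "A *\<^sub>v x"] by simp
  also have "\<dots> = 0\<^sub>v n"
    using no map_less jn by (intro eq_vecI) (auto simp: x_def)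
  finally have "A *\<^sub>v x = 0\<^sub>v n"
    using kernel_square_diagonalizable[OF pullback_mat_carrier diag x] by simp
  then have "vec n (\<lambda>k. x $ \<pi> k) $ l = 0" using l unfolding Ax by simp
  then show False using l jn by (simp add: x_def)
qed

end

section \<open>Jordan chains for the eigenvalue zero\<close>

context ring_with_trees begin

text \<open>The chain is determined by its first vector, \<open>u j = A\<^sup>j\<^sup>-\<^sup>1 u
  1\<close>.\<close>

lemma jordan_chain_zero_iff_powers:
  fixes u :: "nat \<Rightarrow> 'k::field vec"
  shows "jordan_chain_zero A s u \<longleftrightarrow>
    1 \<le> s \<and> u 1 \<in> carrier_vec n \<and>
    (\<forall>j\<in>{1..s}. u j = vec n (\<lambda>i. u 1 $ (\<pi> ^^ (j - 1)) i)) \<and>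
    u s \<noteq> 0\<^sub>v n \<and> (\<forall>i<n. u 1 $ (\<pi> ^^ s) i = 0)"
    (is "?chain \<longleftrightarrow> ?powers")
proof
  assume chain: ?chain
  then have s: "1 \<le> s" and car: "\<And>j. j \<in> {1..s} \<Longrightarrow> u j \<in> carrier_vec n"
    and us: "u s \<noteq> 0\<^sub>v n" "A *\<^sub>v u s = 0 \<cdot>\<^sub>v u s"
    and step: "\<And>j. j \<in> {2..s} \<Longrightarrow> A *\<^sub>v u (j - 1) = u j"
    by (auto simp: jordan_chain_zero_def eigenvector_def)
  have pow: "k < s \<Longrightarrow> u (Suc k) = vec n (\<lambda>i. u 1 $ (\<pi> ^^ k) i)" for k
  proof (induction k)
    case 0
    then show ?case using car[of 1] by (intro eq_vecI) auto
  next
    case (Suc k)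
    have "u (Suc (Suc k)) = A *\<^sub>v u (Suc k)" using step[of "Suc (Suc k)"] Suc.prems by simp
    also have "\<dots> = vec n (\<lambda>i. u (Suc k) $ \<pi> i)"
      using car[of "Suc k"] Suc.prems by (intro A_mult_vec) simp
    also have "\<dots> = vec n (\<lambda>i. u 1 $ (\<pi> ^^ Suc k) i)"
      using Suc map_less by (intro eq_vecI) (auto simp: funpow_swap1)
    finally show ?case .
  qed
  have last: "u 1 $ (\<pi> ^^ s) i = 0" if i: "i < n" for i
  proof -
    obtain k where k: "s = Suc k" using s by (cases s) auto
    have "u s $ \<pi> i = (A *\<^sub>v u s) $ i" using A_mult_vec[OF car[of s]] s i by simp
    also have "\<dots> = 0" using us(2) car[of s] s i by simp
    finally show ?thesis using pow[of k] k map_less[OF i] by (simp add: funpow_swap1)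
  qed
  have pow': "u j = vec n (\<lambda>i. u 1 $ (\<pi> ^^ (j - 1)) i)" if "j \<in> {1..s}" for j
    using pow[of "j - 1"] that by (cases j) auto
  have "u 1 \<in> carrier_vec n" using car[of 1] s by simp
  then show ?powers
    using s us(1) by (intro conjI ballI allI impI) (assumption | rule last | rule pow')+
next
  assume powers: ?powers
  then have s: "1 \<le> s" and us: "u s \<noteq> 0\<^sub>v n" and last: "\<And>i. i < n \<Longrightarrow> u 1 $ (\<pi> ^^ s) i = 0"
    and pow: "\<And>j. j \<in> {1..s} \<Longrightarrow> u j = vec n (\<lambda>i. u 1 $ (\<pi> ^^ (j - 1)) i)"
    by blast+
  have sI: "s \<in> {1..s}" using s by simp
  have car: "u j \<in> carrier_vec n" if "j \<in> {1..s}" for j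
    by (subst pow[OF that]) simp
  have mult: "A *\<^sub>v u j = vec n (\<lambda>i. u 1 $ (\<pi> ^^ j) i)" if j: "j \<in> {1..s}" for j
  proof -
    obtain k where k: "j = Suc k" using j by (cases j) auto
    have "A *\<^sub>v u j = vec n (\<lambda>i. u j $ \<pi> i)" by (rule A_mult_vec[OF car[OF j]])
    also have "\<dots> = vec n (\<lambda>i. u 1 $ (\<pi> ^^ j) i)"
      by (subst pow[OF j], rule eq_vecI) (auto simp: map_less k funpow_swap1)
    finally show ?thesis .
  qed
  have "A *\<^sub>v u s = 0 \<cdot>\<^sub>v u s"
    unfolding mult[OF sI] using car[OF sI] last by (intro eq_vecI) auto
  moreover have "A *\<^sub>v u (j - 1) = u j" if j: "j \<in> {2..s}" for j
  proof -
    have "j - 1 \<in> {1..s}" using j by auto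
    from mult[OF this] have "A *\<^sub>v u (j - 1) = vec n (\<lambda>i. u 1 $ (\<pi> ^^ (j - 1)) i)" .
    also have "\<dots> = u j" by (rule pow[symmetric]) (use j in simp)
    finally show ?thesis .
  qed
  moreover note s us car car[OF sI]
  ultimately show ?chain
    unfolding jordan_chain_zero_def eigenvector_def dim_pullback_mat
    by (intro conjI ballI) assumption+
qed

text \<open>Here \<open>H x\<close> is the number of levels of the tree below \<open>x\<close>:
  the assumptions say that \<open>H x - 1\<close> is the largest \<open>k\<close> for which
  \<open>\<pi>\<^sup>k\<close> attains \<open>x\<close>. The set \<open>S\<close> is the support
  of \<open>u 1\<close> and \<open>\<alpha>\<close> lists its nonzero coordinates. The condition
  \<open>u 1 \<circ> \<pi>\<^sup>s = 0\<close> says that \<open>\<pi>\<^sup>s\<close> avoids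
  \<open>S\<close>; it keeps \<open>S\<close> off the ring, on which \<open>\<pi>\<^sup>s\<close>
  is onto, and gives \<open>H \<le> s\<close> on \<open>S\<close>. The condition \<open>u s
  \<noteq> 0\<close> says that \<open>\<pi>\<^sup>s\<^sup>-\<^sup>1\<close> meets
  \<open>S\<close>, which means that \<open>H x = s\<close> for some \<open>x\<close> in
  \<open>S\<close>.\<close>

lemma jordan_chain_zero_iff_supported:
  fixes u :: "nat \<Rightarrow> 'k::field vec" and H :: "nat \<Rightarrow> nat"
  assumes s: "1 \<le> s"
    and H_pos: "\<And>x. m \<le> x \<Longrightarrow> x < n \<Longrightarrow> 0 < H x"
    and H_attained: "\<And>x. m \<le> x \<Longrightarrow> x < n \<Longrightarrow> \<exists>i<n. (\<pi> ^^ (H x - 1)) i = x"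
    and H_bound: "\<And>x i k. m \<le> x \<Longrightarrow> x < n \<Longrightarrow> i < n \<Longrightarrow> (\<pi> ^^ k) i = x \<Longrightarrow> k < H x"
  shows "jordan_chain_zero A s u \<longleftrightarrow>
    (\<exists>S \<alpha>. S \<subseteq> {m..<n} \<and> S \<noteq> {} \<and> s = Max (H ` S) \<and> (\<forall>x\<in>S. \<alpha> x \<noteq> 0) \<and>
       (\<forall>j\<in>{1..s}. u j = vec n (\<lambda>i. if (\<pi> ^^ (j - 1)) i \<in> S then \<alpha> ((\<pi> ^^ (j - 1)) i) else 0)))"
    (is "?chain \<longleftrightarrow> ?supported")
proof
  assume ?chain
  then have u1: "u 1 \<in> carrier_vec n" and us: "u s \<noteq> 0\<^sub>v n"
    and last: "\<And>i. i < n \<Longrightarrow> u 1 $ (\<pi> ^^ s) i = 0"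
    and pow: "\<And>j. j \<in> {1..s} \<Longrightarrow> u j = vec n (\<lambda>i. u 1 $ (\<pi> ^^ (j - 1)) i)"
    unfolding jordan_chain_zero_iff_powers by blast+
  define S where "S = {x. x < n \<and> u 1 $ x \<noteq> 0}"
  have "m \<le> x" if x: "x \<in> S" for x
  proof (rule ccontr)
    assume "\<not> m \<le> x"
    then have xm: "x < m" by simp
    \<comment> \<open>\<open>y\<close> lies \<open>s\<close> steps behind \<open>x\<close> on the ring.\<close>
    define y where "y = (x + (m - 1) * s) mod m"
    have "(\<pi> ^^ s) y = (x + (m - 1) * s + s) mod m"
      using m_pos pow_ring[of y s] by (simp add: y_def mod_add_left_eq)
    also have "x + (m - 1) * s + s = x + m * s" using m_pos by (cases m) auto
    also have "(x + m * s) mod m = x" using xm by simp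
    finally have "(\<pi> ^^ s) y = x" .
    moreover have "y < m" using m_pos by (simp add: y_def)
    ultimately have "u 1 $ x = 0" using last[of y] m_le_n by simp
    then show False using x by (simp add: S_def)
  qed
  then have S: "S \<subseteq> {m..<n}" by (auto simp: S_def)
  have fin: "finite S" by (simp add: S_def)
  have le: "H x \<le> s" if x: "x \<in> S" for x
  proof (rule ccontr)
    assume "\<not> H x \<le> s"
    have "m \<le> x" "x < n" using x S by auto
    then obtain i where i: "i < n" "(\<pi> ^^ (H x - 1)) i = x" using H_attained by blast
    define d where "d = H x - 1 - s"
    have "H x - 1 = s + d" using \<open>\<not> H x \<le> s\<close> by (simp add: d_def)
    then have "(\<pi> ^^ s) ((\<pi> ^^ d) i) = x" using i(2) by (simp add: funpow_add)
    with last[OF pow_less[OF i(1)], of d] x show False by (simp add: S_def)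
  qed
  have sI: "s \<in> {1..s}" using s by simp
  have "\<exists>i<n. u s $ i \<noteq> 0"
  proof (rule ccontr)
    assume "\<not> (\<exists>i<n. u s $ i \<noteq> 0)"
    moreover have "dim_vec (u s) = n" by (subst pow[OF sI]) simp
    ultimately have "u s = 0\<^sub>v n" by (intro eq_vecI) auto
    with us show False by simp
  qed
  then obtain i where i: "i < n" "u s $ i \<noteq> 0" by blast
  define x where "x = (\<pi> ^^ (s - 1)) i"
  have "u s $ i = u 1 $ x" by (subst pow[OF sI]) (use i(1) in \<open>simp add: x_def\<close>)
  then have x: "x \<in> S" using i pow_less[OF i(1)] by (simp add: S_def x_def)
  then have "s \<le> H x" using H_bound[of x i "s - 1"] S i(1) s by (auto simp: x_def)
  then have "H x = s" using le[OF x] by simp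
  then have "s = Max (H ` S)" using fin x le by (intro Max_eqI[symmetric]) auto
  moreover have "u j = vec n (\<lambda>i. if (\<pi> ^^ (j - 1)) i \<in> S then u 1 $ (\<pi> ^^ (j - 1)) i else 0)"
    if "j \<in> {1..s}" for j
    by (subst pow[OF that]) (auto simp: S_def pow_less intro!: eq_vecI)
  moreover have "u 1 $ x \<noteq> 0" if "x \<in> S" for x using that by (simp add: S_def)
  moreover have "S \<noteq> {}" using x by blast
  moreover note S
  ultimately show ?supported
    by (intro exI[of _ S] exI[of _ "\<lambda>x. u 1 $ x"] conjI ballI) assumption+
next
  assume ?supported
  then obtain S \<alpha> where S: "S \<subseteq> {m..<n}" "S \<noteq> {}" "s = Max (H ` S)"
    and \<alpha>: "\<And>x. x \<in> S \<Longrightarrow> \<alpha> x \<noteq> 0"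
    and u: "\<And>j. j \<in> {1..s} \<Longrightarrow>
      u j = vec n (\<lambda>i. if (\<pi> ^^ (j - 1)) i \<in> S then \<alpha> ((\<pi> ^^ (j - 1)) i) else 0)"
    by blast
  have fin: "finite S" using S(1) finite_subset by blast
  have u1: "u 1 $ i = (if i \<in> S then \<alpha> i else 0)" if "i < n" for i
    using u[of 1] s that by simp
  have "s \<in> H ` S" using Max_in[of "H ` S"] fin S(2,3) by simp
  then obtain x where x: "x \<in> S" "H x = s" by auto
  then have "m \<le> x" "x < n" using S(1) by auto
  with x obtain i where i: "i < n" "(\<pi> ^^ (s - 1)) i = x" using H_attained by metis
  have "u s $ i = \<alpha> x" using u[of s] s i x by simp
  then have "u s \<noteq> 0\<^sub>v n" using \<alpha>[OF x(1)] i(1) by auto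
  moreover have "u 1 $ (\<pi> ^^ s) i = 0" if i: "i < n" for i
  proof -
    have "(\<pi> ^^ s) i \<notin> S"
    proof
      assume y: "(\<pi> ^^ s) i \<in> S"
      then have "s < H ((\<pi> ^^ s) i)" using S(1) i by (intro H_bound) auto
      moreover have "H ((\<pi> ^^ s) i) \<le> s" using y fin S(3) by simp
      ultimately show False by simp
    qed
    then show ?thesis using u1[OF pow_less[OF i]] by simp
  qed
  moreover have "u 1 \<in> carrier_vec n" using u[of 1] s by simp
  moreover have "u j = vec n (\<lambda>i. u 1 $ (\<pi> ^^ (j - 1)) i)" if "j \<in> {1..s}" for j
    by (subst u[OF that]) (auto simp: u1[simplified] pow_less intro!: eq_vecI)
  moreover note s
  ultimately show ?chain
    unfolding jordan_chain_zero_iff_powers by (intro conjI ballI allI impI) assumption+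
qed

end

section \<open>Numbered networks\<close>

lemma adjacency_entry_eq_0_iff:
  assumes "finite (arcs N)" "i < n" "j < n"
  shows "adjacency_mat N n c $$ (i, j) = (0 :: real) \<longleftrightarrow>
    (\<forall>e\<in>arcs N. \<not> (tail N e = c j \<and> head N e = c i))"
  using assms by (auto simp: adjacency_mat_def)

text \<open>The assumptions on the numbering are what the block form of the adjacency matrix says
  about the feeder map.\<close>

locale numbered_network = one_input_graph N for N :: "('a, 'b) pre_digraph" (structure) +
  fixes c :: "nat \<Rightarrow> 'a" and m n :: nat
  assumes m_pos: "0 < m" and m_le_n: "m \<le> n"
    and bij: "bij_betw c {..<n} (verts N)"
    and ring_numbers: "c ` {..<m} = ring_cells N"
    and ring_order: "i < m \<Longrightarrow> feeder (c i) = c (Suc i mod m)"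
    and tree_order: "m \<le> i \<Longrightarrow> i < n \<Longrightarrow> j < n \<Longrightarrow> feeder (c i) = c j \<Longrightarrow> j < i"
begin

definition \<pi> :: "nat \<Rightarrow> nat" where
  "\<pi> i = inv_into {..<n} c (feeder (c i))"

lemma c_in_verts: "i < n \<Longrightarrow> c i \<in> verts N"
  using bij by (auto simp: bij_betw_def)

lemma c_eq_iff: "i < n \<Longrightarrow> j < n \<Longrightarrow> c i = c j \<longleftrightarrow> i = j"
  using bij by (auto simp: bij_betw_def inj_on_def)

lemma number_exists:
  assumes "v \<in> verts N"
  obtains i where "i < n" "v = c i"
  using assms bij by (auto simp: bij_betw_def)

lemma \<pi>_less: "i < n \<Longrightarrow> \<pi> i < n"
  and c_\<pi>: "i < n \<Longrightarrow> c (\<pi> i) = feeder (c i)"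
proof -
  assume i: "i < n"
  have v: "feeder (c i) \<in> c ` {..<n}"
    using feeder_in_verts[OF c_in_verts[OF i]] bij by (auto simp: bij_betw_def)
  show "\<pi> i < n" using inv_into_into[OF v] by (simp add: \<pi>_def)
  show "c (\<pi> i) = feeder (c i)" using f_inv_into_f[OF v] by (simp add: \<pi>_def)
qed

lemma c_ring_iff: 
  assumes i: "i < n"
  shows "c i \<in> ring_cells N \<longleftrightarrow> i < m"
proof
  assume "c i \<in> ring_cells N"
  then obtain j where "j < m" "c i = c j" using ring_numbers by auto
  then show "i < m" using c_eq_iff i m_le_n by auto
next
  assume "i < m"
  then show "c i \<in> ring_cells N" using ring_numbers by blast
qed

sublocale ring_with_trees \<pi> m n
proof
  show "0 < m" "m \<le> n" by (rule m_pos m_le_n)+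
next
  fix i assume i: "i < m"
  then have less: "i < n" "Suc i mod m < n"
    using m_le_n mod_less_divisor[OF m_pos, of "Suc i"] by linarith+
  have "c (\<pi> i) = c (Suc i mod m)" using c_\<pi>[OF less(1)] ring_order[OF i] by simp
  then show "\<pi> i = Suc i mod m" using c_eq_iff \<pi>_less less by blast
next
  fix i assume i: "m \<le> i" "i < n"
  show "\<pi> i < i" using tree_order[OF i \<pi>_less] c_\<pi> i by simp
qed

lemma c_pow: "i < n \<Longrightarrow> c ((\<pi> ^^ k) i) = (feeder ^^ k) (c i)"
  by (induction k) (simp_all add: c_\<pi> pow_less)

lemma pow_eq_iff: "i < n \<Longrightarrow> x < n \<Longrightarrow> (\<pi> ^^ k) i = x \<longleftrightarrow> (feeder ^^ k) (c i) = c x"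
  using c_pow[of i k] c_eq_iff[OF pow_less[of i k], of x] by auto

lemma adjacency_mat_eq: "adjacency_mat N n c = pullback_mat n \<pi>"
proof (rule eq_matI)
  fix i j assume "i < dim_row (pullback_mat n \<pi>)" "j < dim_col (pullback_mat n \<pi>)"
  then have ij: "i < n" "j < n" by simp_all
  obtain e where e: "e \<in> arcs N" "head N e = c i" "tail N e = feeder (c i)"
    using in_arc_exists[OF c_in_verts[OF ij(1)]] .
  have "{f \<in> arcs N. tail N f = c j \<and> head N f = c i} = (if j = \<pi> i then {e} else {})"
  proof -
    let ?E = "{f \<in> arcs N. tail N f = c j \<and> head N f = c i}"
    have "f = e" if "f \<in> ?E" for f
      using that e in_arc_unique[of f e] by simp
    then have sub: "?E \<subseteq> {e}" by blast
    have "e \<in> ?E \<longleftrightarrow> j = \<pi> i"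
      using e c_\<pi>[OF ij(1)] c_eq_iff[OF \<pi>_less[OF ij(1)] ij(2)] by auto
    then show ?thesis using sub by (cases "j = \<pi> i") auto
  qed
  then show "adjacency_mat N n c $$ (i, j) = pullback_mat n \<pi> $$ (i, j)"
    using ij by (simp add: adjacency_mat_def pullback_mat_def)
qed (simp_all add: adjacency_mat_def)

abbreviation leaf_numbers :: "nat set" where
  "leaf_numbers \<equiv> {..<n} - \<pi> ` {..<n}"

lemma leaf_numbers_non_ring: "leaf_numbers \<subseteq> {m..<n}"
proof
  fix i assume i: "i \<in> leaf_numbers"
  have "\<not> i < m"
  proof
    assume im: "i < m"
    \<comment> \<open>the predecessor of \<open>i\<close> on the ring\<close>
    have "\<pi> ((i + (m - 1)) mod m) = Suc (i + (m - 1)) mod m"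
      using ring m_pos by (simp add: mod_Suc_eq)
    also have "\<dots> = i" using im by simp
    finally have "i \<in> \<pi> ` {..<m}" using m_pos by (metis imageI lessThan_iff mod_less_divisor)
    then show False using i m_le_n by auto
  qed
  with i show "i \<in> {m..<n}" by simp
qed

lemma bij_betw_leaf_numbers: "bij_betw c leaf_numbers (leaves N)"
proof -
  have verts: "verts N = c ` {..<n}" using bij by (simp add: bij_betw_def)
  have leaf: "c i \<in> leaves N \<longleftrightarrow> i \<notin> \<pi> ` {..<n}" if i: "i < n" for i
  proof -
    have step: "feeder (c k) = c i \<longleftrightarrow> \<pi> k = i" if k: "k < n" for k
      using c_\<pi>[OF k] c_eq_iff[OF \<pi>_less[OF k] i] by simp
    have "c i \<in> leaves N \<longleftrightarrow> (\<forall>e\<in>arcs N. tail N e \<noteq> c i)"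
      using c_in_verts[OF i] by (simp add: leaves_iff)
    also have "\<dots> \<longleftrightarrow> (\<forall>v\<in>verts N. feeder v \<noteq> c i)"
      using feeder_head head_in_verts in_arc_exists by metis
    also have "\<dots> \<longleftrightarrow> (\<forall>k<n. feeder (c k) \<noteq> c i)"
      by (auto simp: verts)
    also have "\<dots> \<longleftrightarrow> (\<forall>k<n. \<pi> k \<noteq> i)"
      using step by blast
    finally show ?thesis by auto
  qed
  have "c ` leaf_numbers = leaves N"
  proof (intro Set.set_eqI iffI)
    fix v assume v: "v \<in> leaves N"
    then obtain i where "i < n" "v = c i" using number_exists by (auto simp: leaves_iff)
    with v leaf show "v \<in> c ` leaf_numbers" by blast
  qed (use leaf in auto)
  then show ?thesis using bij by (auto simp: bij_betw_def intro: inj_on_subset)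
qed

lemma network_depth_eq_0_iff_numbers: "network_depth N = 0 \<longleftrightarrow> m = n"
proof -
  have "card (ring_cells N) = m"
    using ring_numbers bij m_le_n card_image[of c "{..<m}"]
    by (auto simp: bij_betw_def intro: inj_on_subset)
  moreover have "card (verts N) = n" using bij_betw_same_card[OF bij] by simp
  moreover have "ring_cells N \<subseteq> verts N" using ring_cells_in_verts by blast
  ultimately have "ring_cells N = verts N \<longleftrightarrow> m = n"
    using card_subset_eq[OF finite_verts] by auto
  then show ?thesis by (simp add: network_depth_eq_0_iff)
qed

lemma not_diagonalizable_if_deep:
  assumes "1 < network_depth N"
  shows "\<not> diagonalizable (pullback_mat n \<pi> :: 'k::field mat)"
proof -
  obtain v where v: "v \<in> verts N" "feeder v \<notin> ring_cells N"
    using network_depth_gt_1[OF assms] .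
  then obtain i where i: "i < n" "v = c i" using number_exists by blast
  then have "\<not> \<pi> i < m" using v c_\<pi> c_ring_iff[OF \<pi>_less] by simp
  then show ?thesis using not_diagonalizable[of i] i by simp
qed

text \<open>The kernel is the coordinate subspace of the leaves, and \<open>tail_leaf\<close>
  turns an enumeration of the tails into one of the leaves.\<close>

lemma kernel_basis:
  fixes V0 :: "('k::field, 'k vec) module"
  defines "V0 \<equiv> eigenspace_module (pullback_mat n \<pi> :: 'k mat) 0"
  shows "vectorspace.dim class_ring V0 = card (network_tails N)"
    and "bij_betw \<tau> {..<card (network_tails N)} (network_tails N) \<Longrightarrow>
      \<exists>i. (\<forall>j<card (network_tails N). i j \<in> {m..<n} \<and> c (i j) = tail_leaf N (\<tau> j)) \<and>
        inj_on (\<lambda>j. unit_vec n (i j) :: 'k vec) {..<card (network_tails N)} \<and>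
        vectorspace.basis class_ring V0 ((\<lambda>j. unit_vec n (i j)) ` {..<card (network_tails N)})"
proof -
  interpret vec_space "TYPE('k)" n .
  have V0: "V0 = V\<lparr>carrier :=
      {v \<in> carrier_vec n. \<forall>i<n. i \<notin> leaf_numbers \<longrightarrow> v $ i = 0}\<rparr>"
    by (simp only: V0_def eigenspace_0 dim_pullback_mat)
  have sub: "leaf_numbers \<subseteq> {..<n}" by blast
  have "card leaf_numbers = card (network_tails N)"
    using bij_betw_same_card bij_betw_leaf_numbers bij_betw_tail_leaf by metis
  then show "vectorspace.dim class_ring V0 = card (network_tails N)"
    unfolding V0 using coordinate_subspace(3)[OF sub] by simp
  assume \<tau>: "bij_betw \<tau> {..<card (network_tails N)} (network_tails N)"
  define i where "i = inv_into leaf_numbers c \<circ> (tail_leaf N \<circ> \<tau>)"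
  have tl: "bij_betw (tail_leaf N \<circ> \<tau>) {..<card (network_tails N)} (leaves N)"
    using \<tau> bij_betw_tail_leaf by (rule bij_betw_trans)
  then have i: "bij_betw i {..<card (network_tails N)} leaf_numbers"
    unfolding i_def by (rule bij_betw_trans) (rule bij_betw_inv_into[OF bij_betw_leaf_numbers])
  have "i j \<in> {m..<n} \<and> c (i j) = tail_leaf N (\<tau> j)" if j: "j < card (network_tails N)" for j
  proof -
    have "i j \<in> leaf_numbers" using i j by (auto simp: bij_betw_def)
    moreover have "tail_leaf N (\<tau> j) \<in> leaves N" using tl j by (auto simp: bij_betw_def)
    then have "c (i j) = tail_leaf N (\<tau> j)"
      using bij_betw_inv_into_right[OF bij_betw_leaf_numbers] by (simp add: i_def)
    ultimately show ?thesis using leaf_numbers_non_ring by blast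
  qed
  moreover have "inj_on (\<lambda>j. unit_vec n (i j) :: 'k vec) {..<card (network_tails N)}"
  proof (rule inj_onI)
    fix j l assume jl: "j \<in> {..<card (network_tails N)}" "l \<in> {..<card (network_tails N)}"
      "unit_vec n (i j) = (unit_vec n (i l) :: 'k vec)"
    have "i j < n" "i l < n" using jl i by (auto simp: bij_betw_def)
    with jl(3) have "i j = i l" by (metis index_unit_vec(1) zero_neq_one)
    then show "j = l" using i jl by (auto simp: bij_betw_def inj_on_def)
  qed
  moreover have "(\<lambda>j. unit_vec n (i j) :: 'k vec) ` {..<card (network_tails N)} = unit_vec n ` leaf_numbers"
    using i by (simp add: bij_betw_def image_image[symmetric])
  moreover have "vectorspace.basis class_ring V0 (unit_vec n ` leaf_numbers)"
    unfolding V0 by (rule coordinate_subspace(2)[OF sub])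
  ultimately show "\<exists>i. (\<forall>j<card (network_tails N). i j \<in> {m..<n} \<and> c (i j) = tail_leaf N (\<tau> j)) \<and>
        inj_on (\<lambda>j. unit_vec n (i j) :: 'k vec) {..<card (network_tails N)} \<and>
        vectorspace.basis class_ring V0 ((\<lambda>j. unit_vec n (i j)) ` {..<card (network_tails N)})"
    by (intro exI[of _ i]) simp
qed

abbreviation subtree_of :: "nat \<Rightarrow> ('a, 'b) pre_digraph" where
  "subtree_of x \<equiv> offspring (c x)"

lemma c_non_ring: "x \<in> {m..<n} \<Longrightarrow> c x \<in> verts N \<and> c x \<notin> ring_cells N"
  using c_in_verts[of x] c_ring_iff[of x] by auto

lemma cells_at_subtree_of:
  assumes "x \<in> {m..<n}" "i < n"
  shows "c i \<in> cells_at (subtree_of x) k \<longleftrightarrow> (\<pi> ^^ k) i = x"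
  using assms cells_at_offspring[of "c x" k] c_non_ring[of x] c_in_verts[of i] pow_eq_iff[of i x k]
  by auto

lemma levels_subtree_of_attained:
  assumes "x \<in> {m..<n}"
  shows "\<exists>i<n. (\<pi> ^^ (levels (subtree_of x) - 1)) i = x"
proof -
  interpret D: arborescence "subtree_of x" "c x"
    using c_non_ring[OF assms] by (intro arborescence_offspring) auto
  obtain v where v: "v \<in> cells_at (subtree_of x) (depth (subtree_of x))"
    using D.cells_at_depth by blast
  then have "v \<in> verts N" using c_non_ring[OF assms] cells_at_offspring[of "c x"] by auto
  then obtain i where "i < n" "v = c i" using number_exists by blast
  with v show ?thesis using cells_at_subtree_of[OF assms] by (auto simp: levels_def)
qed

lemma less_levels_subtree_of:
  assumes x: "x \<in> {m..<n}" and i: "i < n" and "(\<pi> ^^ k) i = x"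
  shows "k < levels (subtree_of x)"
proof -
  interpret D: arborescence "subtree_of x" "c x"
    using c_non_ring[OF x] by (intro arborescence_offspring) auto
  have "c i \<in> cells_at (subtree_of x) k" using assms cells_at_subtree_of by simp
  then show ?thesis using D.cells_at_beyond_depth[of k] by (fastforce simp: levels_def)
qed

text \<open>The image of the unit vector at \<open>x\<close> under the \<open>k\<close>-th power
  of the adjacency matrix: the indicator of the cells at distance \<open>k\<close> below
  \<open>x\<close>.\<close>

definition level_vec :: "nat \<Rightarrow> nat \<Rightarrow> real vec" where
  "level_vec x k = vec n (\<lambda>i. if (\<pi> ^^ k) i = x then 1 else 0)"

lemma level_vec_carrier [simp]: "level_vec x k \<in> carrier_vec n"
  by (simp add: level_vec_def)

lemma level_vec_eq_finsum:
  assumes "x \<in> {m..<n}"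
  shows "finsum_vec TYPE(real) n (unit_vec n) {l. l < n \<and> c l \<in> cells_at (subtree_of x) k} =
    level_vec x k"
proof -
  have "finsum_vec TYPE(real) n (unit_vec n) {l. l < n \<and> c l \<in> cells_at (subtree_of x) k} =
      vec n (\<lambda>i. if i \<in> {l. l < n \<and> c l \<in> cells_at (subtree_of x) k} then 1 else 0)"
    by (rule finsum_unit_vec) auto
  also have "\<dots> = level_vec x k"
    using cells_at_subtree_of[OF assms] by (intro eq_vecI) (simp_all add: level_vec_def)
  finally show ?thesis .
qed

lemma level_vec_0: "x < n \<Longrightarrow> level_vec x 0 = unit_vec n x"
  by (intro eq_vecI) (auto simp: level_vec_def)

lemma level_vec_beyond:
  assumes "x \<in> {m..<n}" "levels (subtree_of x) \<le> k"
  shows "level_vec x k = 0\<^sub>v n"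
proof (rule eq_vecI)
  fix i assume "i < dim_vec (0\<^sub>v n :: real vec)"
  then have i: "i < n" by simp
  have "(\<pi> ^^ k) i \<noteq> x"
    using less_levels_subtree_of[OF assms(1) i, of k] assms(2) by auto
  then show "level_vec x k $ i = 0\<^sub>v n $ i" using i by (simp add: level_vec_def)
qed (simp add: level_vec_def)

lemma smult_zero_n: "(a :: real) \<cdot>\<^sub>v 0\<^sub>v n = 0\<^sub>v n"
  by (intro eq_vecI) auto

lemma subtree_vectors_imp_level_vec:
  assumes x: "x \<in> {m..<n}" and "subtree_vectors n c s (subtree_of x) w"
  shows "\<exists>\<alpha>. \<alpha> \<noteq> 0 \<and> (\<forall>j\<in>{1..s}. w j = \<alpha> \<cdot>\<^sub>v level_vec x (j - 1))"
proof -
  obtain \<alpha> r where \<alpha>: "\<alpha> \<noteq> 0" and r: "r < n" "c r = root (subtree_of x)" "w 1 = \<alpha> \<cdot>\<^sub>v unit_vec n r"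
    and mid: "\<forall>j. 1 < j \<and> j \<le> levels (subtree_of x) \<longrightarrow>
      w j = \<alpha> \<cdot>\<^sub>v finsum_vec TYPE(real) n (unit_vec n)
        {l. l < n \<and> c l \<in> cells_at (subtree_of x) (j - 1)}"
    and beyond: "\<forall>j. levels (subtree_of x) < j \<and> j \<le> s \<longrightarrow> w j = 0\<^sub>v n"
    using assms(2) unfolding subtree_vectors_def by blast
  have "r = x" using r root_offspring[of "c x"] c_non_ring[OF x] c_eq_iff[of r x] x by auto
  have w: "w j = \<alpha> \<cdot>\<^sub>v level_vec x (j - 1)" if j: "j \<in> {1..s}" for j
  proof -
    consider "j = 1" | "1 < j" "j \<le> levels (subtree_of x)" | "levels (subtree_of x) < j"
      using j by force
    then show ?thesis
    proof cases
      case 1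
      then show ?thesis using r(3) \<open>r = x\<close> level_vec_0[of x] x by simp
    next
      case 2
      then show ?thesis using mid level_vec_eq_finsum[OF x] by simp
    next
      case 3
      then have "level_vec x (j - 1) = 0\<^sub>v n" by (intro level_vec_beyond[OF x]) simp
      then show ?thesis using 3 beyond j smult_zero_n by simp
    qed
  qed
  then show ?thesis using \<alpha> by (intro exI[of _ \<alpha>] conjI ballI w)
qed

lemma subtree_vectors_level_vec:
  assumes x: "x \<in> {m..<n}" and "\<alpha> \<noteq> 0"
  shows "subtree_vectors n c s (subtree_of x) (\<lambda>j. \<alpha> \<cdot>\<^sub>v level_vec x (j - 1))"
  unfolding subtree_vectors_def
proof (intro exI[of _ \<alpha>] conjI allI impI)
  have "c x = root (subtree_of x)" using root_offspring[of "c x"] c_non_ring[OF x] by simp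
  then show "\<exists>r<n. c r = root (subtree_of x) \<and> \<alpha> \<cdot>\<^sub>v level_vec x (1 - 1) = \<alpha> \<cdot>\<^sub>v unit_vec n r"
    using x level_vec_0[of x] by (intro exI[of _ x]) simp
next
  fix j assume "levels (subtree_of x) < j \<and> j \<le> s"
  then have "levels (subtree_of x) \<le> j - 1" by linarith
  then have "level_vec x (j - 1) = 0\<^sub>v n" by (rule level_vec_beyond[OF x])
  then show "\<alpha> \<cdot>\<^sub>v level_vec x (j - 1) = 0\<^sub>v n" using smult_zero_n by simp
qed (simp_all add: level_vec_eq_finsum[OF x] assms(2))

lemma inj_on_subtree_of: "inj_on subtree_of {m..<n}"
proof (rule inj_onI)
  fix x y assume xy: "x \<in> {m..<n}" "y \<in> {m..<n}" "subtree_of x = subtree_of y"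
  then have "c x = c y" using root_offspring c_non_ring by metis
  then show "x = y" using xy c_eq_iff by simp
qed

text \<open>In each coordinate \<open>i\<close> at most one summand is nonzero, the one for the
  cell \<open>k\<close> steps above \<open>i\<close>.\<close>

lemma finsum_subtree_vectors:
  assumes S: "S \<subseteq> {m..<n}"
    and w: "\<And>x. x \<in> S \<Longrightarrow> w (subtree_of x) = \<alpha> x \<cdot>\<^sub>v level_vec x k"
  shows "finsum_vec TYPE(real) n w (subtree_of ` S) =
    vec n (\<lambda>i. if (\<pi> ^^ k) i \<in> S then \<alpha> ((\<pi> ^^ k) i) else 0)"
proof (rule eq_vecI)
  have fin: "finite S" using S finite_subset by blast
  have car: "w \<in> subtree_of ` S \<rightarrow> carrier_vec n" using w by auto
  fix i assume "i < dim_vec (vec n (\<lambda>i. if (\<pi> ^^ k) i \<in> S then \<alpha> ((\<pi> ^^ k) i) else 0))"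
  then have i: "i < n" by simp
  have "finsum_vec TYPE(real) n w (subtree_of ` S) $ i = (\<Sum>B\<in>subtree_of ` S. w B $ i)"
    using fin by (intro index_finsum_vec[OF _ i car]) simp
  also have "\<dots> = (\<Sum>x\<in>S. w (subtree_of x) $ i)"
    using inj_on_subset[OF inj_on_subtree_of S] by (simp add: sum.reindex)
  also have "\<dots> = (\<Sum>x\<in>S. if x = (\<pi> ^^ k) i then \<alpha> ((\<pi> ^^ k) i) else 0)"
    using i by (intro sum.cong) (auto simp: w level_vec_def)
  finally show "finsum_vec TYPE(real) n w (subtree_of ` S) $ i =
      vec n (\<lambda>i. if (\<pi> ^^ k) i \<in> S then \<alpha> ((\<pi> ^^ k) i) else 0) $ i"
    using fin i by simp
next
  have "w \<in> subtree_of ` S \<rightarrow> carrier_vec n" using w by auto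
  then have "finsum_vec TYPE(real) n w (subtree_of ` S) \<in> carrier_vec n"
    by (rule finsum_vec_closed)
  then show "dim_vec (finsum_vec TYPE(real) n w (subtree_of ` S)) =
      dim_vec (vec n (\<lambda>i. if (\<pi> ^^ k) i \<in> S then \<alpha> ((\<pi> ^^ k) i) else 0))" by simp
qed

lemma descendant_closed_subtrees_numbered:
  "{B \<in> network_subtrees N. descendant_closed N B} = subtree_of ` {m..<n}"
proof -
  have "verts N - ring_cells N = c ` {m..<n}"
  proof (intro Set.set_eqI iffI)
    fix v assume v: "v \<in> verts N - ring_cells N"
    then obtain i where i: "i < n" "v = c i" using number_exists by blast
    then have "i \<in> {m..<n}" using v c_ring_iff[OF i(1)] by simp
    then show "v \<in> c ` {m..<n}" using i(2) by blast
  next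
    fix v assume "v \<in> c ` {m..<n}"
    then obtain i where "i \<in> {m..<n}" "v = c i" by blast
    then show "v \<in> verts N - ring_cells N" using c_non_ring[of i] by simp
  qed
  then show ?thesis by (simp add: descendant_closed_subtrees_eq image_image)
qed

text \<open>Nonempty sets of descendant closed subtrees amount to nonempty sets of cells off the
  ring, each subtree being given by its root, and the scalars of the subtrees are the coordinates
  of the first vector of the chain.\<close>

lemma jordan_chain_zero_iff_subtrees:
  assumes s: "1 < s"
  shows "jordan_chain_zero (pullback_mat n \<pi>) s u \<longleftrightarrow>
    (\<exists>J. J \<subseteq> {B \<in> network_subtrees N. descendant_closed N B} \<and> J \<noteq> {} \<and>
       s = Max (levels ` J) \<and> s > 1 \<and>
       (\<exists>w. (\<forall>B\<in>J. subtree_vectors n c s B (w B)) \<and>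
            (\<forall>j\<in>{1..s}. u j = finsum_vec TYPE(real) n (\<lambda>B. w B j) J)))"
    (is "_ \<longleftrightarrow> ?rhs")
proof -
  define H where "H x = levels (subtree_of x)" for x
  have "jordan_chain_zero (pullback_mat n \<pi>) s u \<longleftrightarrow>
    (\<exists>S \<alpha>. S \<subseteq> {m..<n} \<and> S \<noteq> {} \<and> s = Max (H ` S) \<and> (\<forall>x\<in>S. \<alpha> x \<noteq> 0) \<and>
       (\<forall>j\<in>{1..s}. u j = vec n (\<lambda>i. if (\<pi> ^^ (j - 1)) i \<in> S then \<alpha> ((\<pi> ^^ (j - 1)) i) else 0)))"
    (is "_ \<longleftrightarrow> ?supported")
  proof (rule jordan_chain_zero_iff_supported)
    show "1 \<le> s" using s by simp
    show "0 < H x" for x by (simp add: H_def levels_def)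
    show "\<exists>i<n. (\<pi> ^^ (H x - 1)) i = x" if "m \<le> x" "x < n" for x
      using levels_subtree_of_attained that by (simp add: H_def)
    show "k < H x" if "m \<le> x" "x < n" "i < n" "(\<pi> ^^ k) i = x" for x i k
      using less_levels_subtree_of[of x i k] that by (simp add: H_def)
  qed
  also have "?supported \<longleftrightarrow> ?rhs"
  proof
    assume ?supported
    then obtain S \<alpha> where S: "S \<subseteq> {m..<n}" "S \<noteq> {}" "s = Max (H ` S)"
      and \<alpha>: "\<forall>x\<in>S. \<alpha> x \<noteq> 0"
      and u: "\<forall>j\<in>{1..s}. u j = vec n (\<lambda>i. if (\<pi> ^^ (j - 1)) i \<in> S then \<alpha> ((\<pi> ^^ (j - 1)) i) else 0)"
      by blast
    define w where "w B j = (let x = inv_into {m..<n} subtree_of B in \<alpha> x \<cdot>\<^sub>v level_vec x (j - 1))"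
      for B and j :: nat
    have w: "w (subtree_of x) = (\<lambda>j. \<alpha> x \<cdot>\<^sub>v level_vec x (j - 1))" if "x \<in> S" for x
      using inv_into_f_f[OF inj_on_subtree_of, of x] that S(1) by (auto simp: w_def fun_eq_iff Let_def)
    have "subtree_vectors n c s B (w B)" if B: "B \<in> subtree_of ` S" for B
    proof -
      obtain x where x: "x \<in> S" "B = subtree_of x" using B by blast
      then have "x \<in> {m..<n}" "\<alpha> x \<noteq> 0" using S(1) \<alpha> by auto
      then show ?thesis unfolding x(2) w[OF x(1)] by (rule subtree_vectors_level_vec)
    qed
    moreover have "u j = finsum_vec TYPE(real) n (\<lambda>B. w B j) (subtree_of ` S)" if "j \<in> {1..s}" for j
    proof -
      have "finsum_vec TYPE(real) n (\<lambda>B. w B j) (subtree_of ` S) =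
          vec n (\<lambda>i. if (\<pi> ^^ (j - 1)) i \<in> S then \<alpha> ((\<pi> ^^ (j - 1)) i) else 0)"
        by (rule finsum_subtree_vectors[OF S(1), of "\<lambda>B. w B j" \<alpha> "j - 1"]) (simp only: w)
      then show ?thesis using bspec[OF u that] by (simp only:)
    qed
    moreover have "s = Max (levels ` subtree_of ` S)" using S(3) by (simp add: H_def image_image)
    moreover have "subtree_of ` S \<subseteq> {B \<in> network_subtrees N. descendant_closed N B}"
      unfolding descendant_closed_subtrees_numbered using S(1) by blast
    moreover have "subtree_of ` S \<noteq> {}" using S(2) by simp
    moreover note s
    ultimately show ?rhs
      by (intro exI[of _ "subtree_of ` S"] conjI exI[of _ w] ballI) assumption+
  next
    assume ?rhs
    then obtain J w where J: "J \<subseteq> subtree_of ` {m..<n}" "J \<noteq> {}" "s = Max (levels ` J)"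
      and w: "\<forall>B\<in>J. subtree_vectors n c s B (w B)"
      and u: "\<forall>j\<in>{1..s}. u j = finsum_vec TYPE(real) n (\<lambda>B. w B j) J"
      unfolding descendant_closed_subtrees_numbered by blast
    obtain S where S: "S \<subseteq> {m..<n}" "J = subtree_of ` S" using J(1) subset_imageE by metis
    have "\<forall>x\<in>S. \<exists>a. a \<noteq> 0 \<and> (\<forall>j\<in>{1..s}. w (subtree_of x) j = a \<cdot>\<^sub>v level_vec x (j - 1))"
      using subtree_vectors_imp_level_vec w S by blast
    then obtain \<alpha> where \<alpha>: "\<forall>x\<in>S. \<alpha> x \<noteq> 0"
      and w\<alpha>: "\<forall>x\<in>S. \<forall>j\<in>{1..s}. w (subtree_of x) j = \<alpha> x \<cdot>\<^sub>v level_vec x (j - 1)"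
      by metis
    have "u j = vec n (\<lambda>i. if (\<pi> ^^ (j - 1)) i \<in> S then \<alpha> ((\<pi> ^^ (j - 1)) i) else 0)"
      if j: "j \<in> {1..s}" for j
    proof -
      have "finsum_vec TYPE(real) n (\<lambda>B. w B j) J =
          vec n (\<lambda>i. if (\<pi> ^^ (j - 1)) i \<in> S then \<alpha> ((\<pi> ^^ (j - 1)) i) else 0)"
        unfolding S(2) by (rule finsum_subtree_vectors[OF S(1), of "\<lambda>B. w B j" \<alpha> "j - 1"]) (use w\<alpha> j in blast)
      then show ?thesis using bspec[OF u j] by (simp only:)
    qed
    moreover have "s = Max (H ` S)" using J(3) S(2) by (simp add: H_def image_image)
    moreover have "\<alpha> x \<noteq> 0" if "x \<in> S" for x using \<alpha> that by blast
    moreover have "S \<noteq> {}" using S(2) J(2) by blast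
    moreover note S(1)
    ultimately show ?supported
      by (intro exI[of _ S] exI[of _ \<alpha>] conjI ballI) assumption+
  qed
  finally show ?thesis .
qed

end

text \<open>The entry of the adjacency matrix at \<open>(i, j)\<close> is nonzero exactly when
  cell \<open>j\<close> feeds cell \<open>i\<close>. The cyclic block hence gives the order of the
  ring cells. For \<open>i\<close> off the ring, triangularity of \<open>L\<close> excludes
  \<open>j > i\<close>, while \<open>j = i\<close> would be a self-loop and put \<open>i\<close>
  on the ring.\<close>

lemma numbered_networkI:
  fixes N :: "('a, 'b) pre_digraph" and A C B L :: "real mat"
  assumes N: "one_input_network N"
    and m: "1 \<le> m" "m \<le> n"
    and bij: "bij_betw c {..<n} (verts N)"
    and ring: "c ` {..<m} = ring_cells N"
    and A: "A = adjacency_mat N n c"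
    and dims: "B \<in> carrier_mat (n - m) m" "L \<in> carrier_mat (n - m) (n - m)"
    and C: "C = cyclic_perm_mat m"
    and blocks: "A = four_block_mat C (0\<^sub>m m (n - m)) B L"
    and lower: "lower_triangular L"
  shows "numbered_network N c m n"
proof -
  interpret fin_digraph N using N by (simp add: one_input_network_def)
  interpret one_input_graph N by unfold_locales (use N in \<open>simp add: one_input_network_def\<close>)
  have entry: "A $$ (i, j) = 0 \<longleftrightarrow> feeder (c i) \<noteq> c j" if ij: "i < n" "j < n" for i j
  proof -
    have "c i \<in> verts N" using bij ij by (auto simp: bij_betw_def)
    then obtain e where "e \<in> arcs N" "head N e = c i" "tail N e = feeder (c i)" by (rule in_arc_exists)
    then show ?thesis
      unfolding A adjacency_entry_eq_0_iff[OF finite_arcs ij] using feeder_head by metis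
  qed
  have C_dim: "C \<in> carrier_mat m m" by (simp add: C cyclic_perm_mat_def)
  show ?thesis
  proof
    show "0 < m" "m \<le> n" "bij_betw c {..<n} (verts N)" "c ` {..<m} = ring_cells N"
      using m bij ring by simp_all
  next
    fix i assume i: "i < m"
    define j where "j = Suc i mod m"
    have j: "j < m" using m by (simp add: j_def)
    have "A $$ (i, j) = C $$ (i, j)" using i j C_dim dims m unfolding blocks by simp
    also have "\<dots> = 1" using i j by (simp add: C cyclic_perm_mat_def j_def)
    finally have "feeder (c i) = c j" using entry[of i j] i j m by auto
    then show "feeder (c i) = c (Suc i mod m)" by (simp add: j_def)
  next
    fix i j assume ij: "m \<le> i" "i < n" "j < n" "feeder (c i) = c j"
    have "i \<noteq> j"
    proof
      assume "i = j"
      have v: "c i \<in> verts N" using bij ij by (auto simp: bij_betw_def)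
      have "(feeder ^^ 1) (c i) = c i" using ij \<open>i = j\<close> by simp
      then have "c i \<in> ring_cells N" using v unfolding ring_cells_iff by blast
      then obtain k where "k < m" "c i = c k" using ring by auto
      moreover from this have "k < n" using m by simp
      ultimately have "i = k" using bij ij by (auto simp: bij_betw_def inj_on_def)
      with \<open>k < m\<close> ij show False by simp
    qed
    moreover have "\<not> i < j"
    proof
      assume "i < j"
      then have "L $$ (i - m, j - m) = 0" using lower ij dims by (auto simp: lower_triangular_def)
      then have "A $$ (i, j) = 0" using ij \<open>i < j\<close> dims C_dim m unfolding blocks by simp
      then show False using entry ij by simp
    qed
    ultimately show "j < i" by simp
  qed
qed

theorem lemma4p3:
  fixes N :: "('a, 'b) pre_digraph" and c :: "nat \<Rightarrow> 'a" and m n :: nat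
    and A C B L :: "real mat"
  defines "A' \<equiv> map_mat complex_of_real A"
    and "\<omega> \<equiv> root_of_unity m"
    and "t \<equiv> card (network_tails N)"
  assumes "one_input_network N"
    and "1 \<le> m" and "m \<le> n"
    and "bij_betw c {..<n} (verts N)"
    and "card (ring_cells N) = m"
    and "c ` {..<m} = ring_cells N"
    and "A = adjacency_mat N n c"
    and "B \<in> carrier_mat (n - m) m"
    and "L \<in> carrier_mat (n - m) (n - m)"
    and "C = cyclic_perm_mat m"
    and "A = four_block_mat C (0\<^sub>m m (n - m)) B L"
    and "lower_triangular L"
  shows
    \<comment> \<open>(i)\<close>
    "(\<forall>j<m. \<omega> j \<in> spectrum A' \<and>
        (\<exists>v \<in> carrier_vec n.
           (\<forall>i<m. v $ i = \<omega> j ^ i) \<and>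
           (\<forall>i\<in>{m..<n}. \<exists>k<m. v $ i = \<omega> j ^ k) \<and>
           eigenvector A' v (\<omega> j) \<and>
           eigenspace A' (\<omega> j) =
             LinearCombinations.module.span class_ring (module_vec TYPE(complex) n) {v}))
     \<and>
     \<comment> \<open>(ii)\<close>
     (network_depth N = 0 \<longleftrightarrow> m = n) \<and>
     (network_depth N = 0 \<longrightarrow> spectrum A' = \<omega> ` {..<m}) \<and>
     (network_depth N \<noteq> 0 \<longrightarrow>
        spectrum A' = \<omega> ` {..<m} \<union> {0} \<and>
        Polynomial.order 0 (char_poly A') = n - m \<and>
        vectorspace.dim class_ring (eigenspace_module A' 0) = t \<and>
        (\<forall>\<tau>. bij_betw \<tau> {..<t} (network_tails N) \<longrightarrow>
           (\<exists>i. (\<forall>j<t. i j \<in> {m..<n} \<and> c (i j) = tail_leaf N (\<tau> j)) \<and>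
                inj_on (\<lambda>j. unit_vec n (i j) :: complex vec) {..<t} \<and>
                vectorspace.basis class_ring (eigenspace_module A' 0)
                  ((\<lambda>j. unit_vec n (i j)) ` {..<t}))))
     \<and>
     \<comment> \<open>(iii)\<close>
     (network_depth N > 1 \<longrightarrow>
        \<not> diagonalizable A' \<and>
        (\<forall>s>1. \<forall>u :: nat \<Rightarrow> real vec.
           jordan_chain_zero A s u \<longleftrightarrow>
             (\<exists>J. J \<subseteq> {\<B> \<in> network_subtrees N. descendant_closed N \<B>} \<and> J \<noteq> {} \<and>
                  s = Max (levels ` J) \<and> s > 1 \<and>
                  (\<exists>w. (\<forall>\<B>\<in>J. subtree_vectors n c s \<B> (w \<B>)) \<and>
                       (\<forall>j\<in>{1..s}. u j = finsum_vec TYPE(real) n (\<lambda>\<B>. w \<B> j) J)))))"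
proof -
  interpret numbered_network N c m n
    using assms(4-7,9-15) by (rule numbered_networkI)
  have A: "A = pullback_mat n \<pi>" using assms(10) adjacency_mat_eq by simp
  then have A': "A' = pullback_mat n \<pi>"
    by (auto simp: A'_def pullback_mat_def intro!: eq_matI)
  have roots: "\<omega> ` {..<m} = {z. z ^ m = 1}"
    unfolding \<omega>_def using m_pos by (rule roots_of_unity)
  have depth0: "network_depth N = 0 \<longleftrightarrow> m = n" by (rule network_depth_eq_0_iff_numbers)
  have \<omega>_power: "\<omega> j ^ m = 1" if "j < m" for j using roots that by blast
  then have "\<omega> j \<in> spectrum A'" if "j < m" for j
    unfolding A' spectrum_eq using that by simp
  moreover have "\<exists>v \<in> carrier_vec n.
           (\<forall>i<m. v $ i = \<omega> j ^ i) \<and>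
           (\<forall>i\<in>{m..<n}. \<exists>k<m. v $ i = \<omega> j ^ k) \<and>
           eigenvector A' v (\<omega> j) \<and>
           eigenspace A' (\<omega> j) =
             LinearCombinations.module.span class_ring (module_vec TYPE(complex) n) {v}"
    if j: "j < m" for j
  proof -
    note \<omega>j = \<omega>_power[OF j]
    have "\<forall>i<m. wave (\<omega> j) $ i = \<omega> j ^ i"
      using m_le_n phase_ring by (simp add: wave_def)
    moreover have "\<forall>i\<in>{m..<n}. \<exists>k<m. wave (\<omega> j) $ i = \<omega> j ^ k"
    proof
      fix i assume "i \<in> {m..<n}"
      then show "\<exists>k<m. wave (\<omega> j) $ i = \<omega> j ^ k"
        using phase_less by (intro exI[of _ "phase i"]) (simp add: wave_def)
    qed
    moreover have "eigenspace A' (\<omega> j) =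
        LinearCombinations.module.span class_ring (module_vec TYPE(complex) n) {wave (\<omega> j)}"
      unfolding A' eigenspace_root_of_unity[OF \<omega>j] by (rule vec_space.span_single[symmetric]) simp
    moreover have "eigenvector A' (wave (\<omega> j)) (\<omega> j)" unfolding A' by (rule wave_eigenvector[OF \<omega>j])
    ultimately show ?thesis using wave_carrier by blast
  qed
  moreover have "spectrum A' = \<omega> ` {..<m}" if "network_depth N = 0"
    unfolding A' spectrum_eq roots using that depth0 by simp
  moreover have "spectrum A' = \<omega> ` {..<m} \<union> {0}" if "network_depth N \<noteq> 0"
    unfolding A' spectrum_eq roots using that depth0 m_le_n by simp
  moreover have "Polynomial.order 0 (char_poly A') = n - m"
    unfolding A' by (rule order_0_char_poly)
  moreover have "vectorspace.dim class_ring (eigenspace_module A' 0) = t"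
    unfolding A' t_def by (rule kernel_basis)
  moreover have "\<exists>i. (\<forall>j<t. i j \<in> {m..<n} \<and> c (i j) = tail_leaf N (\<tau> j)) \<and>
                inj_on (\<lambda>j. unit_vec n (i j) :: complex vec) {..<t} \<and>
                vectorspace.basis class_ring (eigenspace_module A' 0)
                  ((\<lambda>j. unit_vec n (i j)) ` {..<t})"
    if "bij_betw \<tau> {..<t} (network_tails N)" for \<tau>
    using that unfolding A' t_def by (rule kernel_basis)
  moreover have "\<not> diagonalizable A'" if "network_depth N > 1"
    unfolding A' by (rule not_diagonalizable_if_deep[OF that])
  moreover note depth0
  moreover note jordan_chain_zero_iff_subtrees[folded A]
  ultimately show ?thesis by (intro conjI allI impI) assumption+
qed

end
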